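(* Let $n\in\mathbb{N}$, $s,k\in\mathbb{Z}$ be such that $(s,n)=1$ and $\nu_p(n)-\nu_p(k)\ne 1$ for every prime $p\mid n$. Write $n=n_1n_2$ with $n_1,n_2\in\mathbb{N}$, $(n_1,n_2)=1$, such that $\nu_p(n)\ge \nu_p(k)+2$ for every prime $p\mid n_1$, and $\nu_p(n)\le \nu_p(k)$ for every prime $p\mid n_2$. i) If $m\in\mathbb{R}$, $m\ne 1$, then $$\sum_{\substack{a=1\\ (a,n)=1}}^n (a-s,n)^m e(ak/n) = e(ks/n)\, J_m(n_1)\,\sigma_{1-m}((n_1,k))\,\varphi(n_2)\, F_m(n_2),$$ where $$F_m(n_2):=\sum_{d\mid n_2}\frac{J_m(d)}{\varphi(d)} = \prod_{p\mid n_2}\left(1+\frac{p^m-1}{p-1}\cdot\frac{p^{(m-1)\nu_p(n_2)}-1}{p^{m-1}-1}\right).$$ For $m=1$, $$\sum_{\substack{a=1\\ (a,n)=1}}^n (a-s,n)\, e(ak/n) = e(ks/n)\,\varphi(n)\,\tau((n,k)).$$ ii) If $m\in\mathbb{R}$, $m\ne 1$, then $$\sum_{\substack{a=1\\ (a,n)=1}}^n \sigma_m((a-s,n))\, e(ak/n) = e(ks/n)\, n_1^m\,\sigma_{1-m}((n_1,k))\,\varphi(n_2)\, G_m(n_2),$$ where $$G_m(n_2):=\sum_{d\mid n_2}\frac{d^m}{\varphi(d)} = \prod_{p\mid n_2}\left(1+\frac{p^m}{p-1}\cdot\frac{p^{(m-1)\nu_p(n_2)}-1}{p^{m-1}-1}\right).$$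 For $m=1$, $$\sum_{\substack{a=1\\ (a,n)=1}}^n \sigma((a-s,n))\, e(ak/n) = e(ks/n)\, n_1\,\tau((n_1,k))\,\varphi(n_2)\, G_1(n_2),$$ where $$G_1(n_2):=\sum_{d\mid n_2}\frac{d}{\varphi(d)} = \prod_{p\mid n_2}\left(1+\frac{p\,\nu_p(n_2)}{p-1}\right).$$ iii) We have $$\sum_{\substack{a=1\\ (a,n)=1}}^n c_n(a-s)\, e(ak/n) = \begin{cases} e(ks/n)\, n_1, & \text{if } (n_1,k)=1 \text{ and } n_2 \text{ is squarefree},\\ 0, & \text{otherwise}.\end{cases}$$
   Context: $\mathbb{N}=\{1,2,\ldots\}$; $(a,b)$ is the greatest common divisor of $a,b\in\mathbb{Z}$; $\varphi$ is Euler's totient function; $e(x)=e^{2\pi i x}$ for $x\in\mathbb{R}$; $\sigma_m(n)=\sum_{d\mid n} d^m$ for $m\in\mathbb{R}$, $\sigma=\sigma_1$, $\tau=\sigma_0$ (number of divisors); $J_m(n)=n^m\prod_{p\mid n}(1-1/p^m)$ for $m\in\mathbb{R}$ (Jordan function); $c_n(k)=\sum_{1\le a\le n,\,(a,n)=1} e(ak/n)$ is Ramanujan's sum ($n\in\mathbb{N}$, $k\in\mathbb{Z}$); $\nu_p(n)$ is the exponent of the prime $p$ in the prime factorization of $n\in\mathbb{Z}$, with the convention $\nu_p(0)=\infty$. All divisors in sums are positive, and products over $p\mid n_2$ are over the primes dividing $n_2$. The decomposition $n=n_1n_2$ exists and is unique under the stated hypothesis: $n_1$ is the product of the prime powers $p^{\nu_p(n)}$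 over primes $p\mid n$ with $\nu_p(n)\ge\nu_p(k)+2$, and $n_2$ is the product of $p^{\nu_p(n)}$ over primes $p\mid n$ with $\nu_p(n)\le\nu_p(k)$. *)

theory Defs
  imports
    Complex_Main
    "HOL-Library.Extended_Nat"
    "HOL-Computational_Algebra.Squarefree"
    "HOL-Number_Theory.Totient"
begin

definition unit_e :: "real \<Rightarrow> complex" where
  "unit_e x = exp (2 * of_real pi * \<i> * of_real x)"

definition sigma :: "real \<Rightarrow> nat \<Rightarrow> real" where
  "sigma m n = (\<Sum>d | d dvd n. real d powr m)"

abbreviation tau :: "nat \<Rightarrow> real" where
  "tau \<equiv> sigma 0"

definition jordan :: "real \<Rightarrow> nat \<Rightarrow> real" where
  "jordan m n = real n powr m * (\<Prod>p\<in>prime_factors n. 1 - 1 / real p powr m)"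

definition ramanujan_sum :: "nat \<Rightarrow> int \<Rightarrow> complex" where
  "ramanujan_sum n k = (\<Sum>a\<in>totatives n. unit_e (of_int (int a * k) / real n))"

(* The library has multiplicity p 0 = 0; the convention here is that the valuation of 0
   is infinite. *)
definition nu :: "nat \<Rightarrow> int \<Rightarrow> enat" where
  "nu p n = (if n = 0 then \<infinity> else enat (multiplicity (int p) n))"

definition nu_split :: "nat \<Rightarrow> int \<Rightarrow> nat \<Rightarrow> nat \<Rightarrow> bool" where
  "nu_split n k n1 n2 \<longleftrightarrow>
     n1 > 0 \<and> n2 > 0 \<and> n = n1 * n2 \<and> coprime n1 n2 \<and>
     (\<forall>p. prime p \<and> p dvd n1 \<longrightarrow> nu p (int n) \<ge> nu p k + 2) \<and>
     (\<forall>p. prime p \<and> p dvd n2 \<longrightarrow> nu p (int n) \<le> nu p k)"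

definition F_sum :: "real \<Rightarrow> nat \<Rightarrow> real" where
  "F_sum m n = (\<Sum>d | d dvd n. jordan m d / real (totient d))"

definition G_sum :: "real \<Rightarrow> nat \<Rightarrow> real" where
  "G_sum m n = (\<Sum>d | d dvd n. real d powr m / real (totient d))"

end

theory Submission
  imports Defs "HOL-Library.Real_Mod"
begin

text \<open>
  Each of the weights \<open>(a - s, n)\<^sup>m\<close>, \<open>\<sigma>\<^sub>m((a - s, n))\<close> and \<open>c\<^sub>n(a - s)\<close> is a sum of values
  \<open>g(d)\<close> over the common divisors \<open>d\<close> of \<open>n\<close> and \<open>a - s\<close>, with \<open>g(d)\<close> equal to \<open>J\<^sub>m(d)\<close>, \<open>d\<^sup>m\<close> and
  \<open>d \<mu>(n/d)\<close> respectively. Exchanging the summations leaves, for every \<open>d\<close> dividing \<open>n\<close>, the sum of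
  \<open>e(ak/n)\<close> over the units \<open>a\<close> modulo \<open>n\<close> in the class of \<open>s\<close> modulo \<open>d\<close>, and this sum is
  explicit (lemma \<open>sum_class_unit_e\<close>).

  If \<open>n/d\<close> divides \<open>k\<close>, then \<open>e(ak/n)\<close> is constant on the class, and the class contains
  \<open>\<phi>(n)/\<phi>(d)\<close> units. Otherwise some prime \<open>p\<close> occurs in \<open>n/d\<close> with exponent above \<open>b = \<nu>\<^sub>p(k)\<close>.
  The hypothesis that \<open>\<nu>\<^sub>p(n) - \<nu>\<^sub>p(k)\<close> is never 1 gives \<open>\<nu>\<^sub>p(n) \<ge> b + 2\<close>, so the translation by
  \<open>h = n/p\<^bsup>b+1\<^esup>\<close> is by a multiple of \<open>d\<close> and of every prime factor of \<open>n\<close>. It permutes the units in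
  the class but multiplies every term by \<open>e(hk/n) \<noteq> 1\<close>, and the sum vanishes.

  With \<open>e = n/d\<close> the whole sum becomes \<open>e(ks/n)\<close> times the sum of \<open>g(n/e) \<phi>(n)/\<phi>(n/e)\<close> over the
  divisors \<open>e\<close> of \<open>(n, k)\<close> (lemma \<open>twisted_totative_sum\<close>). Since \<open>n\<^sub>2\<close> divides \<open>k\<close>, such an \<open>e\<close>
  is a divisor of \<open>(n\<^sub>1, k)\<close> times an arbitrary divisor of \<open>n\<^sub>2\<close>, and for multiplicative weights the
  sum factors accordingly. In the first factor \<open>n\<^sub>1/e\<close> has the same prime factors as \<open>n\<^sub>1\<close>, because
  the exponents in \<open>n\<^sub>1\<close> exceed those in \<open>k\<close>; hence \<open>\<phi>(n\<^sub>1)/\<phi>(n\<^sub>1/e) = e\<close> and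
  \<open>J\<^sub>m(n\<^sub>1/e) = J\<^sub>m(n\<^sub>1)/e\<^sup>m\<close>, which produces \<open>\<sigma>\<^bsub>1-m\<^esub>((n\<^sub>1, k))\<close>. The second factor is
  \<open>\<phi>(n\<^sub>2)\<close> times the divisor sum of \<open>g/\<phi>\<close>; for the Jordan and power weights it is \<open>F\<^sub>m\<close> or \<open>G\<^sub>m\<close>,
  whose Euler products are geometric sums, and for Ramanujan's sum Moebius inversion of
  \<open>n/\<phi>(n) = \<Sum>\<^bsub>d dvd n\<^esub> \<mu>\<^sup>2(d)/\<phi>(d)\<close> shows that it is the indicator of squarefreeness.
\<close>

section \<open>Divisor sums of multiplicative functions\<close>

text \<open>
  A divisor \<open>d\<close> of \<open>ab\<close> factors uniquely along \<open>a\<close> and \<open>b\<close>, the factors being \<open>gcd d a\<close> and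
  \<open>gcd d b\<close>.
\<close>
lemma sum_divisors_coprime_mult:
  fixes F :: "nat \<Rightarrow> 'a::comm_monoid_add"
  assumes "coprime a b" "a > 0" "b > 0"
  shows "(\<Sum>d | d dvd a * b. F d) = (\<Sum>x | x dvd a. \<Sum>y | y dvd b. F (x * y))"
proof -
  have "gcd (x * y) a = x" "gcd (x * y) b = y" if "x dvd a" "y dvd b" for x y
  proof -
    have "coprime a y" using assms(1) \<open>y dvd b\<close> by (meson coprime_divisors dvd_refl)
    then show "gcd (x * y) a = x" using \<open>x dvd a\<close>
      by (metis coprime_commute gcd.commute gcd_mult_left_right_cancel gcd_proj1_iff normalize_nat_def id_apply)
    have "coprime b x" using assms(1) \<open>x dvd a\<close> by (meson coprime_commute coprime_divisors dvd_refl)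
    then show "gcd (x * y) b = y" using \<open>y dvd b\<close>
      by (metis coprime_commute gcd.commute gcd_mult_left_left_cancel gcd_proj1_iff normalize_nat_def id_apply)
  qed note gcds = this
  have prod: "gcd d a * gcd d b = d" if "d dvd a * b" for d
  proof -
    obtain x y where "x dvd a" "y dvd b" "d = x * y"
      using division_decomp[OF \<open>d dvd a * b\<close>] by blast
    then show ?thesis using gcds by simp
  qed
  have "(\<Sum>d | d dvd a * b. F d) = (\<Sum>(x, y)\<in>{x. x dvd a} \<times> {y. y dvd b}. F (x * y))"
    by (rule sum.reindex_bij_witness[where i = "\<lambda>(x, y). x * y" and j = "\<lambda>d. (gcd d a, gcd d b)"])
       (auto simp: gcds prod intro: mult_dvd_mono)
  then show ?thesis by (simp add: sum.cartesian_product)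
qed

lemma sum_divisors_prime_power:
  fixes F :: "nat \<Rightarrow> 'a::comm_monoid_add"
  assumes "prime p"
  shows "(\<Sum>d | d dvd p ^ k. F d) = (\<Sum>i\<le>k. F (p ^ i))"
proof -
  have "{d. d dvd p ^ k} = (\<lambda>i. p ^ i) ` {..k}"
    using divides_primepow_nat[OF assms] by auto
  moreover have "inj_on (\<lambda>i. p ^ i) {..k}"
    using prime_gt_1_nat[OF assms] by (auto simp: inj_on_def)
  ultimately show ?thesis by (simp add: sum.reindex)
qed

lemma sum_divisors_flip:
  fixes F :: "nat \<Rightarrow> 'a::comm_monoid_add"
  assumes "n > 0"
  shows "(\<Sum>d | d dvd n \<and> P d. F d) = (\<Sum>d | d dvd n \<and> P (n div d). F (n div d))"
  by (rule sum.reindex_bij_witness[where i = "\<lambda>d. n div d" and j = "\<lambda>d. n div d"])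
     (use assms in \<open>auto elim!: dvdE\<close>)

text \<open>
  The equation is required for positive arguments only: real powers and divisor sums
  behave irregularly at 0.
\<close>
definition multiplicative :: "(nat \<Rightarrow> real) \<Rightarrow> bool" where
  "multiplicative f \<longleftrightarrow>
     f 1 = 1 \<and> (\<forall>a b. 0 < a \<longrightarrow> 0 < b \<longrightarrow> coprime a b \<longrightarrow> f (a * b) = f a * f b)"

lemma multiplicativeD:
  "multiplicative f \<Longrightarrow> 0 < a \<Longrightarrow> 0 < b \<Longrightarrow> coprime a b \<Longrightarrow> f (a * b) = f a * f b"
  by (simp add: multiplicative_def)

lemma multiplicative_mult:
  "multiplicative f \<Longrightarrow> multiplicative g \<Longrightarrow> multiplicative (\<lambda>n. f n * g n)"
  by (simp add: multiplicative_def)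

lemma multiplicative_divide:
  "multiplicative f \<Longrightarrow> multiplicative g \<Longrightarrow> multiplicative (\<lambda>n. f n / g n)"
  by (simp add: multiplicative_def)

lemma multiplicative_powr: "multiplicative (\<lambda>n. real n powr m)"
  by (simp add: multiplicative_def powr_mult)

lemma multiplicative_totient: "multiplicative (\<lambda>n. real (totient n))"
  by (simp add: multiplicative_def totient_mult_coprime)

lemma multiplicative_prod_prime_factors: "multiplicative (\<lambda>n. \<Prod>p\<in>prime_factors n. g p)"
  unfolding multiplicative_def
proof (intro conjI allI impI)
  fix a b :: nat assume ab: "0 < a" "0 < b" "coprime a b"
  have "prime_factors (a * b) = prime_factors a \<union> prime_factors b"
    using ab by (simp add: prime_factors_product)
  moreover have "prime_factors a \<inter> prime_factors b = {}"
    using ab(3) by (auto simp: in_prime_factors_iff dest: coprime_common_divisor_nat)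
  ultimately show "(\<Prod>p\<in>prime_factors (a * b). g p)
      = (\<Prod>p\<in>prime_factors a. g p) * (\<Prod>p\<in>prime_factors b. g p)"
    by (simp add: prod.union_disjoint)
qed simp

lemma multiplicative_jordan: "multiplicative (jordan m)"
  unfolding jordan_def[abs_def]
  by (intro multiplicative_mult multiplicative_powr multiplicative_prod_prime_factors)

lemma multiplicative_squarefree: "multiplicative (\<lambda>n. of_bool (squarefree n))"
  by (auto simp: multiplicative_def squarefree_mult_coprime dest: squarefree_multD)

lemma multiplicative_divisor_sum:
  assumes "multiplicative f"
  shows "multiplicative (\<lambda>n. \<Sum>d | d dvd n. f d)"
  unfolding multiplicative_def
proof (intro conjI allI impI)
  show "(\<Sum>d | d dvd 1. f d) = 1"
    using assms by (simp add: multiplicative_def)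
  fix a b :: nat assume ab: "0 < a" "0 < b" "coprime a b"
  have "(\<Sum>d | d dvd a * b. f d) = (\<Sum>x | x dvd a. \<Sum>y | y dvd b. f (x * y))"
    using ab by (simp add: sum_divisors_coprime_mult)
  also have "\<dots> = (\<Sum>x | x dvd a. \<Sum>y | y dvd b. f x * f y)"
    using ab by (intro sum.cong refl multiplicativeD[OF assms]) 
      (auto intro: coprime_divisors dvd_pos_nat)
  finally show "(\<Sum>d | d dvd a * b. f d) = (\<Sum>d | d dvd a. f d) * (\<Sum>d | d dvd b. f d)"
    by (simp add: sum_product)
qed

lemma multiplicative_prime_power_prod:
  assumes "multiplicative f" "finite A" "\<And>p. p \<in> A \<Longrightarrow> prime p"
  shows "f (\<Prod>p\<in>A. p ^ e p) = (\<Prod>p\<in>A. f (p ^ e p))"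
  using assms(2,3)
proof (induction A rule: finite_induct)
  case empty
  then show ?case using assms(1) by (simp add: multiplicative_def)
next
  case (insert p A)
  have "coprime (p ^ e p) (\<Prod>q\<in>A. q ^ e q)"
  proof (rule prod_coprime_right)
    fix q assume "q \<in> A"
    with insert have "prime p" "prime q" "p \<noteq> q" by auto
    then show "coprime (p ^ e p) (q ^ e q)" by (simp add: primes_coprime)
  qed
  moreover have "0 < p ^ e p" "0 < (\<Prod>q\<in>A. q ^ e q)"
    using insert.prems by (auto intro!: prod_pos simp: prime_gt_0_nat)
  ultimately show ?case
    using insert by (simp add: multiplicativeD[OF assms(1)])
qed

text \<open>
  A multiplicative function is determined by its values at prime powers. Applied to a function
  and to its divisor sum, this is the source of all Euler products below.
\<close>
lemma multiplicative_eq_prod: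
  assumes "multiplicative f" "n > 0"
  shows "f n = (\<Prod>p\<in>prime_factors n. f (p ^ multiplicity p n))"
proof -
  have "f n = f (\<Prod>p\<in>prime_factors n. p ^ multiplicity p n)"
    using prime_factorization_nat[OF assms(2)] by simp
  also have "\<dots> = (\<Prod>p\<in>prime_factors n. f (p ^ multiplicity p n))"
    by (rule multiplicative_prime_power_prod[OF assms(1)]) auto
  finally show ?thesis .
qed

lemma divisor_sum_eq_prod:
  assumes "multiplicative f" "n > 0"
  shows "(\<Sum>d | d dvd n. f d)
    = (\<Prod>p\<in>prime_factors n. \<Sum>i\<le>multiplicity p n. f (p ^ i))"
proof -
  have "(\<Sum>d | d dvd n. f d)
      = (\<Prod>p\<in>prime_factors n. \<Sum>d | d dvd p ^ multiplicity p n. f d)"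
    by (rule multiplicative_eq_prod[OF multiplicative_divisor_sum[OF assms(1)] assms(2)])
  also have "\<dots> = (\<Prod>p\<in>prime_factors n. \<Sum>i\<le>multiplicity p n. f (p ^ i))"
    by (intro prod.cong refl sum_divisors_prime_power) auto
  finally show ?thesis .
qed

section \<open>The Moebius function\<close>

definition moebius :: "nat \<Rightarrow> real" where
  "moebius n = of_bool (squarefree n) * (\<Prod>p\<in>prime_factors n. - 1)"

lemma multiplicative_moebius: "multiplicative moebius"
  unfolding moebius_def[abs_def]
  by (intro multiplicative_mult multiplicative_squarefree multiplicative_prod_prime_factors)

text \<open>
  Local factors of functions such as \<open>\<mu>\<close> and \<open>\<mu>\<^sup>2/\<phi>\<close>, which see only the first power of
  each prime.
\<close>
lemma sum_prime_powers_squarefree: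
  fixes f :: "nat \<Rightarrow> real"
  assumes "prime p" "k > 0" "\<And>n. \<not> squarefree n \<Longrightarrow> f n = 0"
  shows "(\<Sum>i\<le>k. f (p ^ i)) = f 1 + f p"
proof -
  have "f (p ^ i) = 0" if "i \<ge> 2" for i
  proof (rule assms(3), rule not_squarefreeI)
    show "p ^ 2 dvd p ^ i" using that by (rule le_imp_power_dvd)
    show "\<not> p dvd 1" using assms(1) by auto
  qed
  then have "(\<Sum>i\<le>k. f (p ^ i)) = (\<Sum>i\<in>{0,1}. f (p ^ i))"
    using assms(2) by (intro sum.mono_neutral_right) auto
  then show ?thesis by simp
qed

text \<open>
  Every local factor is \<open>\<mu>(1) + \<mu>(p) = 0\<close>, so the Euler product vanishes unless it is empty.
\<close>
lemma moebius_divisor_sum: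
  assumes "n > 0"
  shows "(\<Sum>d | d dvd n. moebius d) = of_bool (n = 1)"
proof -
  have *: "(\<Sum>i\<le>multiplicity p n. moebius (p ^ i)) = 0" if "p \<in> prime_factors n" for p
  proof -
    have "prime p" "multiplicity p n > 0"
      using that by (auto simp: prime_factors_multiplicity)
    then show ?thesis
      by (subst sum_prime_powers_squarefree)
         (auto simp: moebius_def squarefree_prime prime_prime_factors)
  qed
  have "(\<Sum>d | d dvd n. moebius d)
      = (\<Prod>p\<in>prime_factors n. \<Sum>i\<le>multiplicity p n. moebius (p ^ i))"
    by (rule divisor_sum_eq_prod[OF multiplicative_moebius assms])
  also have "\<dots> = (\<Prod>p\<in>prime_factors n. 0)"
    by (intro prod.cong refl *)
  also have "\<dots> = of_bool (n = 1)"
    using assms by (auto simp: prod_constant card_gt_0_iff prime_factorization_empty_iff)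
  finally show ?thesis .
qed

text \<open>
  Exchange the two sums: the coefficient of \<open>g(d)\<close> is the sum of \<open>\<mu>\<close> over the divisors of
  \<open>n/d\<close>, which is 0 unless \<open>d = n\<close>.
\<close>
lemma moebius_inversion:
  assumes "n > 0"
  shows "(\<Sum>e | e dvd n. moebius e * (\<Sum>d | d dvd n div e. g d)) = g n"
proof -
  have "(\<Sum>e | e dvd n. moebius e * (\<Sum>d | d dvd n div e. g d))
      = (\<Sum>e | e dvd n. \<Sum>d | d dvd n \<and> e * d dvd n. moebius e * g d)"
  proof (rule sum.cong[OF refl])
    fix e assume "e \<in> {e. e dvd n}"
    then have "{d. d dvd n div e} = {d. d dvd n \<and> e * d dvd n}"
      using assms by (auto elim!: dvdE)
    then show "moebius e * (\<Sum>d | d dvd n div e. g d)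
        = (\<Sum>d | d dvd n \<and> e * d dvd n. moebius e * g d)"
      by (simp add: sum_distrib_left)
  qed
  also have "\<dots> = (\<Sum>d | d dvd n. \<Sum>e | e dvd n \<and> e * d dvd n. moebius e * g d)"
    using sum.swap_restrict[of "{e. e dvd n}" "{d. d dvd n}" "\<lambda>e d. moebius e * g d" "\<lambda>e d. e * d dvd n"]
      assms by simp
  also have "\<dots> = (\<Sum>d | d dvd n. of_bool (d = n) * g d)"
  proof (rule sum.cong[OF refl])
    fix d assume d: "d \<in> {d. d dvd n}"
    then have "{e. e dvd n \<and> e * d dvd n} = {e. e dvd n div d}"
      using assms by (auto elim!: dvdE)
    moreover have "n div d > 0" "n div d = 1 \<longleftrightarrow> d = n"
      using d assms by (auto elim!: dvdE)
    ultimately show "(\<Sum>e | e dvd n \<and> e * d dvd n. moebius e * g d) = of_bool (d = n) * g d"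
      using moebius_divisor_sum[of "n div d"] by (simp add: sum_distrib_right[symmetric])
  qed
  also have "\<dots> = g n"
    using assms by (subst sum.remove[of _ n]) (auto intro!: sum.neutral)
  finally show ?thesis .
qed

text \<open>
  Compare Euler products: the local factor on the left is \<open>1 + 1/(p - 1) = 1/(1 - 1/p)\<close>.
\<close>
lemma divisor_sum_squarefree_inverse_totient:
  assumes "n > 0"
  shows "(\<Sum>d | d dvd n. of_bool (squarefree d) / real (totient d)) = real n / real (totient n)"
proof -
  define f where "f = (\<lambda>d. of_bool (squarefree d) / real (totient d))"
  have f: "multiplicative f"
    unfolding f_def by (intro multiplicative_divide multiplicative_squarefree multiplicative_totient)
  have *: "(\<Sum>i\<le>multiplicity p n. f (p ^ i)) = 1 / (1 - 1 / real p)" if "p \<in> prime_factors n" for p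
  proof -
    have p: "prime p" "multiplicity p n > 0"
      using that by (auto simp: prime_factors_multiplicity)
    then have "p > 1" using prime_gt_1_nat by blast
    have "(\<Sum>i\<le>multiplicity p n. f (p ^ i)) = f 1 + f p"
      using p by (rule sum_prime_powers_squarefree) (simp add: f_def)
    also have "\<dots> = 1 / (1 - 1 / real p)"
      using p \<open>p > 1\<close> by (simp add: f_def squarefree_prime totient_prime of_nat_diff field_simps)
    finally show ?thesis .
  qed
  have "(\<Sum>d | d dvd n. f d) = (\<Prod>p\<in>prime_factors n. \<Sum>i\<le>multiplicity p n. f (p ^ i))"
    by (rule divisor_sum_eq_prod[OF f assms])
  also have "\<dots> = (\<Prod>p\<in>prime_factors n. 1 / (1 - 1 / real p))"
    by (intro prod.cong refl *)
  also have "\<dots> = real n / real (totient n)"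
    using assms by (simp add: totient_formula2 prod_dividef)
  finally show ?thesis by (simp add: f_def)
qed

text \<open>
  This is the Moebius inversion of \<open>n/\<phi>(n) = \<Sum>\<^bsub>d dvd n\<^esub> \<mu>\<^sup>2(d)/\<phi>(d)\<close>. It evaluates the factor
  belonging to \<open>n\<^sub>2\<close> in the sum with Ramanujan's sum as weight.
\<close>
lemma moebius_totient_sum_squarefree:
  assumes "n > 0"
  shows "real (totient n) * (\<Sum>d | d dvd n. real d * moebius (n div d) / real (totient d))
    = of_bool (squarefree n)"
proof -
  have "(\<Sum>d | d dvd n. real d * moebius (n div d) / real (totient d))
      = (\<Sum>e | e dvd n. real (n div e) * moebius (n div (n div e)) / real (totient (n div e)))"
    using sum_divisors_flip[OF assms, where P = "\<lambda>_. True" and F = "\<lambda>d. real d * moebius (n div d) / real (totient d)"]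
    by simp
  also have "\<dots> = (\<Sum>e | e dvd n. moebius e *
      (\<Sum>d | d dvd n div e. of_bool (squarefree d) / real (totient d)))"
  proof (rule sum.cong[OF refl])
    fix e assume "e \<in> {e. e dvd n}"
    then have "n div e > 0" "n div (n div e) = e"
      using assms by (auto elim!: dvdE)
    then show "real (n div e) * moebius (n div (n div e)) / real (totient (n div e))
        = moebius e * (\<Sum>d | d dvd n div e. of_bool (squarefree d) / real (totient d))"
      by (simp add: divisor_sum_squarefree_inverse_totient)
  qed
  also have "\<dots> = of_bool (squarefree n) / real (totient n)"
    by (rule moebius_inversion[OF assms])
  finally show ?thesis using assms by simp
qed

section \<open>The Jordan function and the Euler products of F and G\<close>

lemma powr_prime_power: "real (p ^ i) powr m = (real p powr m) ^ i"
  by (induction i) (simp_all add: powr_mult)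

lemma jordan_prime_power_Suc:
  assumes "prime p"
  shows "jordan m (p ^ Suc i) = (real p powr m) ^ i * (real p powr m - 1)"
proof -
  have "real p powr m > 0" using prime_gt_0_nat[OF assms] by simp
  moreover have "prime_factors (p ^ Suc i) = {p}"
    using assms by (subst prime_factors_power) (auto simp: prime_prime_factors)
  ultimately show ?thesis
    unfolding jordan_def powr_prime_power by (simp add: field_simps)
qed

lemma jordan_1: "jordan m 1 = 1"
  by (simp add: jordan_def)

text \<open>
  At a prime power the sum telescopes, as \<open>J\<^sub>m(p\<^bsup>i+1\<^esup>) = p\<^bsup>(i+1)m\<^esup> - p\<^bsup>im\<^esup>\<close>; both sides are
  multiplicative.
\<close>
lemma jordan_divisor_sum:
  assumes "n > 0"
  shows "(\<Sum>d | d dvd n. jordan m d) = real n powr m"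
proof -
  have "(\<Sum>i\<le>a. jordan m (p ^ i)) = real (p ^ a) powr m" if "prime p" for p a
  proof (induction a)
    case (Suc a)
    then show ?case
      unfolding sum.atMost_Suc jordan_prime_power_Suc[OF that] powr_prime_power
      by (simp add: algebra_simps)
  qed (simp add: jordan_1[simplified])
  then have "(\<Prod>p\<in>prime_factors n. \<Sum>i\<le>multiplicity p n. jordan m (p ^ i))
      = (\<Prod>p\<in>prime_factors n. real (p ^ multiplicity p n) powr m)"
    by (intro prod.cong refl) auto
  then show ?thesis
    unfolding divisor_sum_eq_prod[OF multiplicative_jordan assms]
    using multiplicative_eq_prod[OF multiplicative_powr assms, of m] by simp
qed

text \<open>
  The local factors of \<open>F\<^sub>m\<close> and \<open>G\<^sub>m\<close> have this form with \<open>q = p\<^bsup>m-1\<^esup>\<close>; this is why \<open>m = 1\<close> is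
  exceptional.
\<close>
lemma prime_power_sum_geometric:
  fixes f :: "nat \<Rightarrow> real"
  assumes "f 1 = 1" "\<And>i. f (p ^ Suc i) = C * q ^ i" "q \<noteq> 1"
  shows "(\<Sum>i\<le>a. f (p ^ i)) = 1 + C * ((q ^ a - 1) / (q - 1))"
proof -
  have "(\<Sum>i\<le>a. f (p ^ i)) = f (p ^ 0) + (\<Sum>i<a. f (p ^ Suc i))"
    by (rule sum.atMost_shift)
  also have "(\<Sum>i<a. f (p ^ Suc i)) = C * (\<Sum>i<a. q ^ i)"
    unfolding assms(2) by (simp add: sum_distrib_left)
  finally show ?thesis using assms(1,3) by (simp add: geometric_sum)
qed

lemma prime_powr_minus_1:
  assumes "prime p"
  shows "real p powr (m - 1) = real p powr m / real p"
  using prime_gt_0_nat[OF assms] by (simp add: powr_diff)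

lemma prime_powr_neq_1:
  assumes "prime p" "m \<noteq> 1"
  shows "real p powr (m - 1) \<noteq> 1"
  using prime_gt_1_nat[OF assms(1)] assms(2) by (simp add: powr_eq_one_iff)

lemma F_sum_eq_prod:
  assumes "n > 0" "m \<noteq> 1"
  shows "F_sum m n = (\<Prod>p\<in>prime_factors n. 1 + (real p powr m - 1) / (real p - 1)
    * ((real p powr ((m - 1) * real (multiplicity p n)) - 1) / (real p powr (m - 1) - 1)))"
proof -
  have "F_sum m n = (\<Prod>p\<in>prime_factors n. \<Sum>i\<le>multiplicity p n.
      jordan m (p ^ i) / real (totient (p ^ i)))"
    unfolding F_sum_def
    by (intro divisor_sum_eq_prod assms multiplicative_divide multiplicative_jordan multiplicative_totient)
  also have "\<dots> = (\<Prod>p\<in>prime_factors n. 1 + (real p powr m - 1) / (real p - 1)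
    * ((real p powr ((m - 1) * real (multiplicity p n)) - 1) / (real p powr (m - 1) - 1)))"
  proof (rule prod.cong[OF refl])
    fix p assume "p \<in> prime_factors n"
    then have p: "prime p" by auto
    have "jordan m (p ^ Suc i) / real (totient (p ^ Suc i))
        = (real p powr m - 1) / (real p - 1) * (real p powr (m - 1)) ^ i" for i
      unfolding jordan_prime_power_Suc[OF p] totient_prime_power_Suc[OF p] prime_powr_minus_1[OF p]
      using prime_gt_1_nat[OF p] by (simp add: of_nat_diff power_divide mult_ac)
    from prime_power_sum_geometric[OF _ this prime_powr_neq_1[OF p assms(2)], of "multiplicity p n"]
    show "(\<Sum>i\<le>multiplicity p n. jordan m (p ^ i) / real (totient (p ^ i)))
      = 1 + (real p powr m - 1) / (real p - 1)
        * ((real p powr ((m - 1) * real (multiplicity p n)) - 1) / (real p powr (m - 1) - 1))"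
      using prime_gt_0_nat[OF p] by (simp add: jordan_1[simplified] powr_power mult.commute)
  qed
  finally show ?thesis .
qed

lemma G_sum_eq_prod_sums:
  assumes "n > 0"
  shows "G_sum m n = (\<Prod>p\<in>prime_factors n. \<Sum>i\<le>multiplicity p n.
      real (p ^ i) powr m / real (totient (p ^ i)))"
  unfolding G_sum_def
  by (intro divisor_sum_eq_prod assms multiplicative_divide multiplicative_powr multiplicative_totient)

lemma G_sum_term:
  assumes "prime p"
  shows "real (p ^ Suc i) powr m / real (totient (p ^ Suc i))
    = real p powr m / (real p - 1) * (real p powr (m - 1)) ^ i"
  unfolding powr_prime_power totient_prime_power_Suc[OF assms] prime_powr_minus_1[OF assms]
  using prime_gt_1_nat[OF assms] by (simp add: of_nat_diff power_divide mult_ac)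

lemma G_sum_eq_prod:
  assumes "n > 0" "m \<noteq> 1"
  shows "G_sum m n = (\<Prod>p\<in>prime_factors n. 1 + real p powr m / (real p - 1)
    * ((real p powr ((m - 1) * real (multiplicity p n)) - 1) / (real p powr (m - 1) - 1)))"
  unfolding G_sum_eq_prod_sums[OF assms(1)]
proof (rule prod.cong[OF refl])
  fix p assume "p \<in> prime_factors n"
  then have p: "prime p" by auto
  from prime_power_sum_geometric[OF _ G_sum_term[OF p, where m = m] prime_powr_neq_1[OF p assms(2)], where a = "multiplicity p n"]
  show "(\<Sum>i\<le>multiplicity p n. real (p ^ i) powr m / real (totient (p ^ i)))
    = 1 + real p powr m / (real p - 1)
      * ((real p powr ((m - 1) * real (multiplicity p n)) - 1) / (real p powr (m - 1) - 1))"
    using prime_gt_0_nat[OF p] by (simp add: powr_power mult.commute)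
qed

text \<open>
  For \<open>m = 1\<close> the geometric sum degenerates to \<open>\<nu>\<^sub>p(n)\<close> equal terms \<open>p/(p - 1)\<close>.
\<close>
lemma G_sum_1_eq_prod:
  assumes "n > 0"
  shows "G_sum 1 n = (\<Prod>p\<in>prime_factors n. 1 + real p * real (multiplicity p n) / (real p - 1))"
  unfolding G_sum_eq_prod_sums[OF assms]
proof (rule prod.cong[OF refl])
  fix p assume "p \<in> prime_factors n"
  then have p: "prime p" by auto
  show "(\<Sum>i\<le>multiplicity p n. real (p ^ i) powr 1 / real (totient (p ^ i)))
      = 1 + real p * real (multiplicity p n) / (real p - 1)"
    unfolding sum.atMost_shift G_sum_term[OF p]
    using prime_gt_0_nat[OF p] by simp
qed

section \<open>Exponentials and periodic functions on residues\<close>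

lemma unit_e_add: "unit_e (x + y) = unit_e x * unit_e y"
  by (simp add: unit_e_def exp_add algebra_simps)

lemma unit_e_eq_1_iff:
  assumes "n > 0"
  shows "unit_e (of_int j / real n) = 1 \<longleftrightarrow> int n dvd j"
proof -
  have "unit_e (of_int j / real n) = cis (2 * pi * (of_int j / real n))"
    by (simp add: unit_e_def cis_conv_exp mult_ac)
  also have "\<dots> = 1 \<longleftrightarrow> (\<exists>q. 2 * pi * (of_int j / real n) = of_int q * (2 * pi))"
    by (rule cis_eq_1_iff)
  also have "\<dots> \<longleftrightarrow> (\<exists>q. real_of_int j = of_int (int n * q))"
    using assms by (simp add: field_simps)
  also have "\<dots> \<longleftrightarrow> int n dvd j"
    unfolding of_int_eq_iff by (auto simp: dvd_def)
  finally show ?thesis .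
qed

lemma unit_e_cong:
  assumes "n > 0" "[x = y] (mod int n)"
  shows "unit_e (of_int x / real n) = unit_e (of_int y / real n)"
proof -
  have "unit_e (of_int x / real n) = unit_e (of_int (x - y) / real n + of_int y / real n)"
    by (simp add: diff_divide_distrib)
  also have "\<dots> = unit_e (of_int (x - y) / real n) * unit_e (of_int y / real n)"
    by (rule unit_e_add)
  also have "unit_e (of_int (x - y) / real n) = 1"
    using assms by (simp add: unit_e_eq_1_iff cong_iff_dvd_diff del: of_int_diff)
  finally show ?thesis by simp
qed

text \<open>
  Sums over units are computed with functions on all integers that depend only on the residue
  modulo \<open>n\<close>, so that translations and multiplications act on them directly.
\<close>
definition periodic :: "nat \<Rightarrow> (int \<Rightarrow> 'a) \<Rightarrow> bool" where
  "periodic n F \<longleftrightarrow> (\<forall>x y. [x = y] (mod int n) \<longrightarrow> F x = F y)"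

lemma periodicD: "periodic n F \<Longrightarrow> [x = y] (mod int n) \<Longrightarrow> F x = F y"
  by (simp add: periodic_def)

lemma periodic_mod: "periodic n F \<Longrightarrow> F (x mod int n) = F x"
  by (rule periodicD) (auto simp: cong_def)

lemma sum_residues_eq:
  fixes F :: "int \<Rightarrow> 'a::comm_monoid_add"
  assumes "n > 0" "periodic n F"
  shows "(\<Sum>a\<in>{0<..n}. F (int a)) = (\<Sum>x\<in>{0..<int n}. F x)"
proof (rule sum.reindex_bij_witness[where i = "\<lambda>x. if x = 0 then n else nat x"
      and j = "\<lambda>a. int a mod int n"])
  fix a assume a: "a \<in> {0<..n}"
  show "(if int a mod int n = 0 then n else nat (int a mod int n)) = a"
  proof (cases "a = n")
    case False
    then have "int a mod int n = int a" using a by simp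
    then show ?thesis using a by simp
  qed simp
  show "int a mod int n \<in> {0..<int n}" using assms(1) by simp
  show "F (int a mod int n) = F (int a)" by (rule periodic_mod[OF assms(2)])
qed (use assms(1) in \<open>auto split: if_splits\<close>)

text \<open>
  Summing over the complete system \<open>{0..<n}\<close> and extending by zero outside the units
  makes the sum over totatives accessible to translation arguments.
\<close>
lemma sum_totatives_eq:
  fixes F :: "int \<Rightarrow> 'a::comm_monoid_add"
  assumes "n > 0" "periodic n F"
  shows "(\<Sum>a\<in>totatives n. F (int a))
    = (\<Sum>x\<in>{0..<int n}. if coprime x (int n) then F x else 0)"
proof -
  have "(\<Sum>a\<in>totatives n. F (int a))
      = (\<Sum>a\<in>{0<..n}. if coprime (int a) (int n) then F (int a) else 0)"
    unfolding totatives_def by (subst sum.inter_filter) (auto intro!: sum.cong)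
  also have "\<dots> = (\<Sum>x\<in>{0..<int n}. if coprime x (int n) then F x else 0)"
  proof (rule sum_residues_eq[OF assms(1)])
    show "periodic n (\<lambda>x. if coprime x (int n) then F x else 0)"
      unfolding periodic_def
      using periodicD[OF assms(2)] cong_imp_coprime by (metis cong_sym)
  qed
  finally show ?thesis .
qed

lemma sum_residues_shift:
  fixes F :: "int \<Rightarrow> 'a::comm_monoid_add"
  assumes "n > 0" "periodic n F"
  shows "(\<Sum>x\<in>{0..<int n}. F (x + h)) = (\<Sum>x\<in>{0..<int n}. F x)"
  by (rule sum.reindex_bij_witness[where i = "\<lambda>x. (x - h) mod int n"
        and j = "\<lambda>x. (x + h) mod int n"])
     (use assms in \<open>auto simp: periodic_mod mod_simps\<close>)

text \<open>
  Multiplication by a unit permutes the residues modulo \<open>n\<close>.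
\<close>
lemma sum_residues_mult:
  fixes F :: "int \<Rightarrow> 'a::comm_monoid_add"
  assumes "n > 0" "periodic n F" "coprime u (int n)"
  shows "(\<Sum>x\<in>{0..<int n}. F (u * x)) = (\<Sum>x\<in>{0..<int n}. F x)"
proof -
  obtain v where v: "[u * v = 1] (mod int n)"
    using cong_solve_coprime_int[OF assms(3)] by blast
  have uv: "v * (u * x) mod int n = x mod int n" "u * (v * x) mod int n = x mod int n" for x
    using cong_scalar_right[OF v, of x] by (simp_all add: cong_def mult_ac)
  show ?thesis
    by (rule sum.reindex_bij_witness[where i = "\<lambda>x. v * x mod int n"
          and j = "\<lambda>x. u * x mod int n"])
       (use assms in \<open>auto simp: periodic_mod mod_simps uv\<close>)
qed

text \<open>
  The sum equals its own translate, which is \<open>c\<close> times the sum. This one principle gives the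
  orthogonality of additive characters and the vanishing of the sums over unit classes.
\<close>
lemma sum_residues_eq_0:
  fixes F :: "int \<Rightarrow> complex"
  assumes "n > 0" "periodic n F" "\<And>x. F (x + h) = c * F x" "c \<noteq> 1"
  shows "(\<Sum>x\<in>{0..<int n}. F x) = 0"
proof -
  have "(\<Sum>x\<in>{0..<int n}. F x) = (\<Sum>x\<in>{0..<int n}. F (x + h))"
    by (rule sum_residues_shift[OF assms(1,2), symmetric])
  also have "\<dots> = c * (\<Sum>x\<in>{0..<int n}. F x)"
    by (simp add: assms(3) sum_distrib_left)
  finally show ?thesis using assms(4) by simp
qed

lemma sum_unit_e_residues:
  assumes "n > 0"
  shows "(\<Sum>a\<in>{0<..n}. unit_e (of_int (int a * j) / real n)) = of_bool (int n dvd j) * of_nat n"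
proof -
  define F where "F x = unit_e (of_int (x * j) / real n)" for x
  have per: "periodic n F"
    unfolding periodic_def F_def by (intro allI impI unit_e_cong assms cong_scalar_right)
  show ?thesis
  proof (cases "int n dvd j")
    case True
    then have "unit_e (of_int (int a * j) / real n) = 1" for a
      by (subst unit_e_eq_1_iff[OF assms]) auto
    then show ?thesis using True by simp
  next
    case False
    have "F (x + 1) = unit_e (of_int j / real n) * F x" for x
      by (simp add: F_def unit_e_add[symmetric] algebra_simps add_divide_distrib)
    moreover have "unit_e (of_int j / real n) \<noteq> 1"
      using False by (simp add: unit_e_eq_1_iff[OF assms])
    ultimately have "(\<Sum>x\<in>{0..<int n}. F x) = 0"
      by (rule sum_residues_eq_0[OF assms per])
    then show ?thesis
      using False sum_residues_eq[OF assms per] by (simp add: F_def)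
  qed
qed

text \<open>
  Detect the condition that \<open>a\<close> is coprime to \<open>n\<close> by a sum of \<open>\<mu>(q)\<close> over the common divisors
  \<open>q\<close>. The multiples of \<open>q\<close> then contribute a complete character sum modulo \<open>n/q\<close>.
\<close>
lemma ramanujan_sum_eq:
  assumes "n > 0"
  shows "ramanujan_sum n j
    = of_real (\<Sum>d | d dvd n \<and> int d dvd j. real d * moebius (n div d))"
proof -
  define E where "E a = unit_e (of_int (int a * j) / real n)" for a
  have inner: "(\<Sum>a | a \<in> {0<..n} \<and> q dvd a. E a) = of_bool (int (n div q) dvd j) * of_nat (n div q)"
    if q: "q dvd n" for q
  proof -
    obtain r where r: "n = q * r" using q ..
    have pos: "q > 0" "r > 0" using assms r by auto
    have "(\<Sum>a | a \<in> {0<..n} \<and> q dvd a. E a)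
        = (\<Sum>c\<in>{0<..r}. unit_e (of_int (int c * j) / real r))"
      by (rule sum.reindex_bij_witness[where i = "\<lambda>c. q * c" and j = "\<lambda>a. a div q"])
         (use pos in \<open>auto simp: r E_def mult.assoc elim!: dvdE\<close>)
    also have "\<dots> = of_bool (int r dvd j) * of_nat r"
      by (rule sum_unit_e_residues[OF pos(2)])
    finally show ?thesis using r pos by simp
  qed
  have "ramanujan_sum n j = (\<Sum>a\<in>{0<..n}. if coprime a n then E a else 0)"
    unfolding ramanujan_sum_def totatives_def E_def by (subst sum.inter_filter) simp_all
  also have "\<dots> = (\<Sum>a\<in>{0<..n}. \<Sum>q | q \<in> {q. q dvd n} \<and> q dvd a. of_real (moebius q) * E a)"
  proof (rule sum.cong[OF refl])
    fix a assume "a \<in> {0<..n}"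
    then have "(\<Sum>q | q dvd gcd n a. moebius q) = of_bool (coprime a n)"
      by (subst moebius_divisor_sum) (auto simp: coprime_iff_gcd_eq_1 gcd.commute)
    then have "(\<Sum>q | q dvd n \<and> q dvd a. moebius q) = of_bool (coprime a n)" by simp
    then show "(if coprime a n then E a else 0)
        = (\<Sum>q | q \<in> {q. q dvd n} \<and> q dvd a. of_real (moebius q) * E a)"
      by (simp flip: sum_distrib_right of_real_sum)
  qed
  also have "\<dots> = (\<Sum>q | q dvd n. \<Sum>a | a \<in> {0<..n} \<and> q dvd a. of_real (moebius q) * E a)"
    using assms by (intro sum.swap_restrict) auto
  also have "\<dots> = (\<Sum>q | q dvd n. of_real (of_bool (int (n div q) dvd j) * (real (n div q) * moebius q)))"
  proof (rule sum.cong[OF refl])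
    fix q assume "q \<in> {q. q dvd n}"
    then have "q dvd n" by simp
    then show "(\<Sum>a | a \<in> {0<..n} \<and> q dvd a. of_real (moebius q) * E a)
        = of_real (of_bool (int (n div q) dvd j) * (real (n div q) * moebius q))"
      by (simp only: sum_distrib_left[symmetric] inner) (simp add: mult_ac)
  qed
  also have "\<dots> = of_real (\<Sum>q | q dvd n. if int (n div q) dvd j then real (n div q) * moebius q else 0)"
    unfolding of_real_sum by (intro sum.cong refl) simp
  also have "(\<Sum>q | q dvd n. if int (n div q) dvd j then real (n div q) * moebius q else 0)
      = (\<Sum>q | q \<in> {q. q dvd n} \<and> int (n div q) dvd j. real (n div q) * moebius q)"
    using assms by (subst sum.inter_filter) simp_all
  also have "\<dots> = (\<Sum>q | q dvd n \<and> int (n div q) dvd j. real (n div q) * moebius (n div (n div q)))"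
    using assms by (intro sum.cong) (auto elim!: dvdE)
  also have "\<dots> = (\<Sum>d | d dvd n \<and> int d dvd j. real d * moebius (n div d))"
    by (rule sum_divisors_flip[OF assms, symmetric])
  finally show ?thesis .
qed

section \<open>Units in a residue class\<close>

lemma coprime_int_iff_primes:
  assumes "n > 0"
  shows "coprime x (int n) \<longleftrightarrow> (\<forall>p. prime p \<longrightarrow> p dvd n \<longrightarrow> \<not> int p dvd x)"
proof (intro iffI allI impI)
  fix p assume "coprime x (int n)" "prime p" "p dvd n"
  then show "\<not> int p dvd x"
    by (meson coprime_common_divisor int_dvd_int_iff not_prime_unit prime_nat_int_transfer)
next
  assume *: "\<forall>p. prime p \<longrightarrow> p dvd n \<longrightarrow> \<not> int p dvd x"
  show "coprime x (int n)"
  proof (rule ccontr)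
    assume "\<not> coprime x (int n)"
    then have "nat (gcd x (int n)) \<noteq> 1"
      by (metis coprime_iff_gcd_eq_1 gcd_ge_0_int int_nat_eq of_nat_1)
    then obtain p where p: "prime p" "p dvd nat (gcd x (int n))"
      using prime_factor_nat by blast
    then have "int p dvd gcd x (int n)"
      by (metis gcd_ge_0_int int_dvd_int_iff int_nat_eq)
    then show False using * p(1) by auto
  qed
qed

text \<open>
  Units modulo \<open>d\<close> lift to units modulo \<open>n\<close>. Take \<open>u = c + dt\<close>, where \<open>t\<close> is the product of the primes
  that divide \<open>n\<close> but not \<open>c\<close>: every prime factor of \<open>n\<close> divides exactly one of the summands
  \<open>c\<close> and \<open>dt\<close>.
\<close>
lemma coprime_lift:
  fixes c :: int
  assumes "d dvd n" "n > 0" "coprime c (int d)"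
  obtains u where "[u = c] (mod int d)" "coprime u (int n)"
proof -
  define P where "P = {p \<in> prime_factors n. \<not> int p dvd c}"
  define t where "t = (\<Prod>p\<in>P. int p)"
  have "finite P" by (simp add: P_def)
  have "\<not> int p dvd c + int d * t" if p: "prime p" "p dvd n" for p
  proof (cases "int p dvd c")
    case True
    have pi: "prime (int p)" using p by simp
    have "\<not> int p dvd int d"
      using True assms(3) p(1) by (meson coprime_common_divisor not_prime_unit pi)
    moreover have "\<not> int p dvd t"
    proof
      assume "int p dvd t"
      then obtain q where q: "q \<in> P" "int p dvd int q"
        unfolding t_def using pi \<open>finite P\<close> by (auto simp: prime_dvd_prod_iff)
      then have "p = q"
        using p by (auto simp: P_def intro: primes_dvd_imp_eq)
      then show False using q True by (simp add: P_def)
    qed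
    ultimately have "\<not> int p dvd int d * t"
      using pi by (simp add: prime_dvd_mult_iff)
    then show ?thesis using True by (simp add: dvd_add_right_iff)
  next
    case False
    then have "p \<in> P" using p assms(2) by (auto simp: P_def in_prime_factors_iff)
    then have "int p dvd t" unfolding t_def using \<open>finite P\<close> by (intro dvd_prodI)
    then show ?thesis using False by (simp add: dvd_add_left_iff)
  qed
  then have "coprime (c + int d * t) (int n)"
    by (simp add: coprime_int_iff_primes[OF assms(2)])
  moreover have "[c + int d * t = c] (mod int d)" by (simp add: cong_def)
  ultimately show ?thesis using that by blast
qed

text \<open>
  Multiplication by a unit modulo \<open>n\<close> that lifts \<open>c\<close> carries the class of 1 modulo \<open>d\<close> to the class of
  \<open>c\<close>. So the \<open>\<phi>(n)\<close> units are distributed evenly among the \<open>\<phi>(d)\<close> classes of units modulo \<open>d\<close>.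
\<close>
lemma card_coprime_residue_class:
  assumes "d dvd n" "n > 0" "coprime s (int d)"
  shows "real (card {x\<in>{0..<int n}. coprime x (int n) \<and> [x = s] (mod int d)})
    = real (totient n) / real (totient d)"
proof -
  have d: "d > 0" using assms by (auto intro: Nat.gr0I)
  define C where "C c x \<longleftrightarrow> coprime x (int n) \<and> [x = c] (mod int d)" for c x
  define N :: "int \<Rightarrow> nat" where "N c = (\<Sum>x\<in>{0..<int n}. of_bool (C c x))" for c
  have dn: "int d dvd int n" using assms(1) by simp
  have per: "periodic n (\<lambda>x. of_bool (C c x) :: nat)" for c
  proof -
    have "C c x \<longleftrightarrow> C c y" if "[x = y] (mod int n)" for x y
      using that cong_dvd_modulus[OF that dn] cong_imp_coprime[OF that]
        cong_imp_coprime[OF cong_sym[OF that]] unfolding C_def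
      by (meson cong_sym cong_trans)
    then show ?thesis by (simp add: periodic_def)
  qed
  have N_eq: "N c = N 1" if c: "coprime c (int d)" for c
  proof -
    obtain u where u: "[u = c] (mod int d)" "coprime u (int n)"
      using coprime_lift[OF assms(1,2) c] .
    have ud: "coprime u (int d)" using u(2) dn by (meson coprime_divisors dvd_refl)
    have "C c (u * x) \<longleftrightarrow> C 1 x" for x
    proof -
      have "[u * x = c] (mod int d) \<longleftrightarrow> [u * x = u * 1] (mod int d)"
        using u(1) by (auto simp: cong_def)
      also have "\<dots> \<longleftrightarrow> [x = 1] (mod int d)" by (rule cong_mult_lcancel[OF ud])
      finally show ?thesis using u(2) by (simp add: C_def)
    qed
    then show ?thesis
      using sum_residues_mult[OF assms(2) per u(2), of c] by (simp add: N_def)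
  qed
  define R where "R m = {x\<in>{0..<int m}. coprime x (int m)}" for m
  have fin: "finite (R d)" unfolding R_def by (rule finite_subset[of _ "{0..<int d}"]) auto
  have card_R: "card (R m) = totient m" if "m > 0" for m
  proof -
    have "(\<Sum>a\<in>totatives m. 1::nat) = (\<Sum>x\<in>{0..<int m}. if coprime x (int m) then 1 else 0)"
      by (rule sum_totatives_eq[OF that]) (simp add: periodic_def)
    also have "\<dots> = card (R m)" by (simp add: R_def sum.inter_filter[symmetric])
    finally show ?thesis by (simp add: totient_def)
  qed
  have "totient n = (\<Sum>x\<in>{0..<int n}. of_bool (coprime x (int n)))"
    using card_R[OF assms(2)] by (simp add: R_def Int_def conj_assoc)
  also have "\<dots> = (\<Sum>x\<in>{0..<int n}. \<Sum>c\<in>R d. of_bool (C c x))"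
  proof (rule sum.cong[OF refl])
    fix x :: int
    show "of_bool (coprime x (int n)) = (\<Sum>c\<in>R d. of_bool (C c x) :: nat)"
    proof (cases "coprime x (int n)")
      case True
      then have "coprime x (int d)" using dn by (meson coprime_divisors dvd_refl)
      then have "x mod int d \<in> R d" using d by (simp add: R_def)
      moreover have "C c x \<longleftrightarrow> c = x mod int d" if "c \<in> R d" for c
        using that True by (auto simp: C_def R_def cong_def)
      ultimately have "(\<Sum>c\<in>R d. of_bool (C c x)) = (\<Sum>c\<in>R d. if c = x mod int d then 1 else (0::nat))"
        by (intro sum.cong refl) auto
      also have "\<dots> = 1"
        using \<open>x mod int d \<in> R d\<close> fin by (simp add: sum.delta)
      finally show ?thesis using True by simp
    qed (simp add: C_def)
  qed
  also have "\<dots> = (\<Sum>c\<in>R d. N c)" unfolding N_def by (rule sum.swap)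
  also have "\<dots> = (\<Sum>c\<in>R d. N s)"
  proof (rule sum.cong[OF refl])
    fix c assume "c \<in> R d"
    then have "coprime c (int d)" by (simp add: R_def)
    then show "N c = N s" by (rule trans[OF N_eq N_eq[OF assms(3), symmetric]])
  qed
  also have "\<dots> = totient d * N s" by (simp add: card_R[OF d])
  finally have "real (totient n) = real (totient d) * real (N s)" by simp
  moreover have "N s = card {x\<in>{0..<int n}. coprime x (int n) \<and> [x = s] (mod int d)}"
    by (simp add: N_def C_def Int_def)
  ultimately show ?thesis using d by (simp add: field_simps)
qed

text \<open>
  The condition \<open>\<nu>\<^sub>p(n) - \<nu>\<^sub>p(k) \<noteq> 1\<close> for natural numbers. For \<open>k = 0\<close> it holds automatically since
  the valuations of 0 are infinite, whereas \<^const>\<open>multiplicity\<close> takes the value 0 there.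
\<close>
definition no_unit_gap :: "nat \<Rightarrow> nat \<Rightarrow> bool" where
  "no_unit_gap n k \<longleftrightarrow> (k \<noteq> 0 \<longrightarrow> (\<forall>p. prime p \<longrightarrow> p dvd n \<longrightarrow>
     multiplicity p n \<noteq> multiplicity p k + 1))"

text \<open>
  If \<open>n/d\<close> divides \<open>k\<close>, all terms equal \<open>e(ks/n)\<close> and only the units in the class have to be counted.
  Otherwise the class is invariant under a translation that multiplies every term by the same
  number different from 1.
\<close>
lemma sum_class_unit_e:
  assumes "n > 0" "d dvd n" "coprime s (int n)" "no_unit_gap n (nat \<bar>k\<bar>)"
  shows "(\<Sum>x\<in>{0..<int n}. if coprime x (int n) \<and> int d dvd x - s
            then unit_e (of_int (x * k) / real n) else 0)
    = unit_e (of_int (k * s) / real n)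
        * of_real (of_bool (n div d dvd nat \<bar>k\<bar>) * real (totient n) / real (totient d))"
proof -
  define E where "E x = unit_e (of_int (x * k) / real n)" for x
  define F where "F x = (if coprime x (int n) \<and> int d dvd x - s then E x else 0)" for x
  have d: "d > 0" using assms by (auto intro: Nat.gr0I)
  have E_cong: "E x = E y" if "[x = y] (mod int n)" for x y
    unfolding E_def using that assms(1) by (intro unit_e_cong cong_scalar_right)
  have E_add: "E (x + y) = E y * E x" for x y
    by (simp add: E_def unit_e_add[symmetric] algebra_simps add_divide_distrib)
  have E1: "E x = 1 \<longleftrightarrow> int n dvd x * k" for x
    unfolding E_def by (rule unit_e_eq_1_iff[OF assms(1)])
  have dvd_iff: "x dvd nat \<bar>k\<bar> \<longleftrightarrow> int x dvd k" for x by (metis abs_ge_zero dvd_abs_iff int_dvd_int_iff int_nat_eq)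
  show ?thesis
  proof (cases "n div d dvd nat \<bar>k\<bar>")
    case True
    then have "int d * int (n div d) dvd int d * k"
      by (simp only: dvd_iff mult_dvd_mono dvd_refl)
    then have nk: "int n dvd int d * k"
      using assms(2) by (simp flip: of_nat_mult)
    have "F x = (if coprime x (int n) \<and> int d dvd x - s then E s else 0)" for x
    proof (cases "int d dvd x - s")
      case dvd: True
      have "int d * k dvd (x - s) * k" using dvd by (rule mult_dvd_mono) simp
      with nk have "int n dvd (x - s) * k" by (rule dvd_trans)
      then have "E (x - s) = 1" by (simp add: E1)
      then have "E x = E s" using E_add[of s "x - s"] by simp
      then show ?thesis by (simp add: F_def)
    qed (simp add: F_def)
    then have "(\<Sum>x\<in>{0..<int n}. F x)
        = (\<Sum>x\<in>{0..<int n}. if coprime x (int n) \<and> int d dvd x - s then E s else 0)"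
      by simp
    also have "\<dots> = (\<Sum>x\<in>{x\<in>{0..<int n}. coprime x (int n) \<and> [x = s] (mod int d)}. E s)"
      by (subst sum.inter_filter) (auto simp: cong_iff_dvd_diff intro!: sum.cong)
    also have "\<dots> = E s * of_real (real (card {x\<in>{0..<int n}. coprime x (int n) \<and> [x = s] (mod int d)}))"
      by simp
    also have "\<dots> = E s * of_real (real (totient n) / real (totient d))"
    proof (subst card_coprime_residue_class[OF assms(2,1)])
      show "coprime s (int d)" using assms(2,3) by (meson coprime_divisors dvd_refl int_dvd_int_iff)
    qed simp
    finally show ?thesis using True unfolding F_def E_def by (simp add: mult.commute)
  next
    case False
    define K where "K = nat \<bar>k\<bar>"
    have K0: "K \<noteq> 0" using False by (auto simp: K_def)
    have nd: "n div d \<noteq> 0"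
      using div_greater_zero_iff[of n d] d dvd_imp_le[OF assms(2,1)] by simp
    obtain p where p: "prime p" "multiplicity p K < multiplicity p (n div d)"
      using False multiplicity_le_imp_dvd[of "n div d" K] nd unfolding K_def
      by (meson linorder_not_less)
    define b where "b = multiplicity p K"
    have pow: "p ^ Suc b dvd n div d"
      using p(2) by (intro multiplicity_dvd') (simp add: b_def)
    then obtain h where h: "n div d = p ^ Suc b * h" ..
    have n_eq: "n = p ^ Suc b * (d * h)"
      using h assms(2) by (metis dvd_mult_div_cancel mult.left_commute)
    have "p dvd n" using n_eq by simp
    then have "multiplicity p n \<noteq> b + 1"
      using assms(4) p(1) K0 by (auto simp: no_unit_gap_def K_def b_def)
    moreover have "multiplicity p n \<ge> b + 1"
      using n_eq assms(1) p(1) by (intro multiplicity_geI) auto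
    ultimately have "p ^ (b + 2) dvd n" by (intro multiplicity_dvd') simp
    then have "p ^ Suc b * p dvd p ^ Suc b * (d * h)" using n_eq by (simp add: mult_ac)
    then have pdh: "p dvd d * h" using p(1) by (simp add: prime_gt_0_nat)
    \<comment> \<open>The translation \<open>H = n / p\<^bsup>b+1\<^esup>\<close>: it is divisible by every prime factor of \<open>n\<close>, including
      \<open>p\<close>, which divides \<open>d * h\<close> by the absence of a gap 1, and \<open>H k / n\<close> is not an integer.\<close>
    define H where "H = int (d * h)"
    have rad: "int q dvd H" if "prime q" "q dvd n" for q
    proof -
      have "q dvd p ^ Suc b \<or> q dvd d * h"
        using that n_eq prime_dvd_mult_iff by blast
      then have "q = p \<or> q dvd d * h"
        using that(1) p(1) by (metis prime_dvd_power primes_dvd_imp_eq)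
      then show ?thesis using pdh by (auto simp: H_def simp del: of_nat_mult)
    qed
    have cop: "coprime (x + H) (int n) \<longleftrightarrow> coprime x (int n)" for x
      using rad by (auto simp: coprime_int_iff_primes[OF assms(1)] dvd_add_left_iff)
    have dH: "int d dvd x + H - s \<longleftrightarrow> int d dvd x - s" for x
    proof -
      have "x + H - s = (x - s) + int d * int h" by (simp add: H_def)
      then show ?thesis by (metis dvd_add_left_iff dvd_triv_left)
    qed
    have "E H \<noteq> 1"
    proof
      assume "E H = 1"
      then have "int (p ^ Suc b) * H dvd k * H"
        by (simp add: E1 n_eq H_def mult_ac)
      moreover have "H \<noteq> 0" using assms(1) n_eq by (auto simp: H_def)
      ultimately have "int (p ^ Suc b) dvd k" by (metis dvd_mult_cancel_right)
      then have "p ^ Suc b dvd K" unfolding K_def by (simp only: dvd_iff)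
      then have "Suc b \<le> b"
        unfolding b_def using K0 p(1) by (intro multiplicity_geI) auto
      then show False by simp
    qed
    moreover have "periodic n F"
      unfolding periodic_def
    proof (intro allI impI)
      fix x y assume xy: "[x = y] (mod int n)"
      have "[x = y] (mod int d)" by (rule cong_dvd_modulus[OF xy]) (use assms(2) in simp)
      then have "int d dvd x - s \<longleftrightarrow> int d dvd y - s"
        by (metis cong_iff_dvd_diff cong_sym cong_trans)
      moreover have "coprime x (int n) \<longleftrightarrow> coprime y (int n)"
        using cong_imp_coprime xy cong_sym by metis
      ultimately show "F x = F y" using E_cong[OF xy] by (simp add: F_def)
    qed
    moreover have "F (x + H) = E H * F x" for x
      by (simp add: F_def cop dH E_add)
    ultimately have "(\<Sum>x\<in>{0..<int n}. F x) = 0"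
      by (intro sum_residues_eq_0[OF assms(1), where h = H and c = "E H"])
    then show ?thesis using False unfolding F_def E_def by simp
  qed
qed

text \<open>
  Exchange the sum over \<open>a\<close> with the divisor sum that defines \<open>f\<close> and evaluate the inner sums over
  unit classes; \<open>e\<close> stands for the complementary divisor \<open>n/d\<close>.
\<close>
lemma twisted_totative_sum:
  fixes f :: "int \<Rightarrow> real" and g :: "nat \<Rightarrow> real"
  assumes "n > 0" "coprime s (int n)" "no_unit_gap n (nat \<bar>k\<bar>)"
    and f: "\<And>x. f x = (\<Sum>d | d dvd n \<and> int d dvd x - s. g d)"
  shows "(\<Sum>a\<in>totatives n. of_real (f (int a)) * unit_e (of_int (int a * k) / real n))
    = unit_e (of_int (k * s) / real n) * of_real
        (\<Sum>e | e dvd gcd n (nat \<bar>k\<bar>). g (n div e) * real (totient n) / real (totient (n div e)))"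
proof -
  define E where "E x = unit_e (of_int (x * k) / real n)" for x
  define w where "w d = g d * real (totient n) / real (totient d)" for d
  have "periodic n (\<lambda>x. of_real (f x) * E x)"
    unfolding periodic_def
  proof (intro allI impI)
    fix x y assume xy: "[x = y] (mod int n)"
    have "int d dvd x - s \<longleftrightarrow> int d dvd y - s" if "d dvd n" for d
    proof -
      have "[x = y] (mod int d)" by (rule cong_dvd_modulus[OF xy]) (use that in simp)
      then show ?thesis by (metis cong_iff_dvd_diff cong_sym cong_trans)
    qed
    then have "f x = f y" unfolding f by (intro sum.cong) auto
    moreover have "E x = E y"
      unfolding E_def by (intro unit_e_cong cong_scalar_right assms(1) xy)
    ultimately show "of_real (f x) * E x = of_real (f y) * E y" by simp
  qed
  then have "(\<Sum>a\<in>totatives n. of_real (f (int a)) * E (int a))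
      = (\<Sum>x\<in>{0..<int n}. if coprime x (int n) then of_real (f x) * E x else 0)"
    by (rule sum_totatives_eq[OF assms(1)])
  also have "\<dots> = (\<Sum>x\<in>{0..<int n}. \<Sum>d | d dvd n.
      of_real (g d) * (if coprime x (int n) \<and> int d dvd x - s then E x else 0))"
  proof (rule sum.cong[OF refl])
    fix x
    have "f x = (\<Sum>d | d \<in> {d. d dvd n} \<and> int d dvd x - s. g d)" by (simp add: f)
    also have "\<dots> = (\<Sum>d | d dvd n. if int d dvd x - s then g d else 0)"
      using assms(1) by (subst sum.inter_filter) simp_all
    finally show "(if coprime x (int n) then of_real (f x) * E x else 0) = (\<Sum>d | d dvd n.
      of_real (g d) * (if coprime x (int n) \<and> int d dvd x - s then E x else 0))"
      by (auto simp: sum_distrib_right intro!: sum.cong)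
  qed
  also have "\<dots> = (\<Sum>d | d dvd n. of_real (g d) *
      (\<Sum>x\<in>{0..<int n}. if coprime x (int n) \<and> int d dvd x - s then E x else 0))"
    by (subst sum.swap) (simp add: sum_distrib_left)
  also have "\<dots> = (\<Sum>d | d dvd n. E s * of_real (if n div d dvd nat \<bar>k\<bar> then w d else 0))"
  proof (rule sum.cong[OF refl])
    fix d assume "d \<in> {d. d dvd n}"
    then have d: "d dvd n" by simp
    show "of_real (g d) * (\<Sum>x\<in>{0..<int n}. if coprime x (int n) \<and> int d dvd x - s then E x else 0)
        = E s * of_real (if n div d dvd nat \<bar>k\<bar> then w d else 0)"
      unfolding E_def sum_class_unit_e[OF assms(1) d assms(2,3)] w_def
      by (simp add: mult_ac)
  qed
  also have "\<dots> = E s * of_real (\<Sum>d | d dvd n. if n div d dvd nat \<bar>k\<bar> then w d else 0)"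
    by (simp add: sum_distrib_left)
  also have "(\<Sum>d | d dvd n. if n div d dvd nat \<bar>k\<bar> then w d else 0)
      = (\<Sum>d | d \<in> {d. d dvd n} \<and> n div d dvd nat \<bar>k\<bar>. w d)"
    using assms(1) by (subst sum.inter_filter) simp_all
  also have "\<dots> = (\<Sum>e | e dvd n \<and> n div (n div e) dvd nat \<bar>k\<bar>. w (n div e))"
    using sum_divisors_flip[OF assms(1), where P = "\<lambda>d. n div d dvd nat \<bar>k\<bar>" and F = w] by simp
  also have "{e. e dvd n \<and> n div (n div e) dvd nat \<bar>k\<bar>} = {e. e dvd gcd n (nat \<bar>k\<bar>)}"
  proof -
    have "e dvd n \<and> n div (n div e) dvd K \<longleftrightarrow> e dvd gcd n K" for e K
      using assms(1) by (cases "e dvd n") (auto elim!: dvdE)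
    then show ?thesis by (simp only:)
  qed
  finally show ?thesis by (simp add: E_def w_def mult.commute)
qed

section \<open>The decomposition of n by valuations\<close>

lemma multiplicity_int_nat_abs:
  assumes "prime p" "k \<noteq> 0"
  shows "multiplicity (int p) k = multiplicity p (nat \<bar>k\<bar>)"
proof -
  have dvd_iff: "int p ^ i dvd k \<longleftrightarrow> p ^ i dvd nat \<bar>k\<bar>" for i
    by (metis abs_ge_zero dvd_abs_iff int_dvd_int_iff int_nat_eq of_nat_power)
  show ?thesis
  proof (rule multiplicity_eqI)
    show "int p ^ multiplicity p (nat \<bar>k\<bar>) dvd k"
      unfolding dvd_iff by (rule multiplicity_dvd)
    show "\<not> int p ^ Suc (multiplicity p (nat \<bar>k\<bar>)) dvd k"
      unfolding dvd_iff using assms by (subst power_dvd_iff_le_multiplicity) auto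
  qed
qed

lemma nu_eq:
  "prime p \<Longrightarrow> nu p k = (if k = 0 then \<infinity> else enat (multiplicity p (nat \<bar>k\<bar>)))"
  by (simp add: nu_def multiplicity_int_nat_abs)

lemma nu_of_nat: "prime p \<Longrightarrow> n > 0 \<Longrightarrow> nu p (int n) = enat (multiplicity p n)"
  by (simp add: nu_eq)

lemma no_unit_gap_nat_abs:
  assumes "n > 0" "\<forall>p::nat. prime p \<and> p dvd n \<longrightarrow> nu p (int n) \<noteq> nu p k + 1"
  shows "no_unit_gap n (nat \<bar>k\<bar>)"
  using assms by (auto simp: no_unit_gap_def nu_of_nat nu_eq one_enat_def)

lemma nu_ge_plus_2_iff:
  assumes "prime p" "n > 0"
  shows "nu p (int n) \<ge> nu p k + 2 \<longleftrightarrow>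
    k \<noteq> 0 \<and> multiplicity p n \<ge> multiplicity p (nat \<bar>k\<bar>) + 2"
  using assms by (simp add: nu_of_nat nu_eq numeral_eq_enat)

lemma nu_le_iff:
  assumes "prime p" "n > 0"
  shows "nu p (int n) \<le> nu p k \<longleftrightarrow>
    k = 0 \<or> multiplicity p n \<le> multiplicity p (nat \<bar>k\<bar>)"
  using assms by (simp add: nu_of_nat nu_eq)

lemma multiplicity_mult_coprime_left:
  fixes a b p :: nat
  assumes "prime p" "p dvd a" "coprime a b" "a > 0" "b > 0"
  shows "multiplicity p (a * b) = multiplicity p a"
proof -
  have "\<not> p dvd b" using assms(1-3) coprime_common_divisor_nat not_prime_1 by blast
  then show ?thesis
    using assms by (simp add: prime_elem_multiplicity_mult_distrib not_dvd_imp_multiplicity_0)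
qed

lemma nu_splitD:
  assumes "nu_split n k n1 n2"
  shows "n1 > 0" "n2 > 0" "n = n1 * n2" "coprime n1 n2"
  using assms by (simp_all add: nu_split_def)

lemma nu_split_dvd:
  assumes "nu_split n k n1 n2"
  shows "n2 dvd nat \<bar>k\<bar>"
proof (cases "k = 0")
  case False
  from assms have n: "n1 > 0" "n2 > 0" "n = n1 * n2" "coprime n1 n2"
    and le: "\<And>p. prime p \<Longrightarrow> p dvd n2 \<Longrightarrow> nu p (int n) \<le> nu p k"
    by (auto simp: nu_split_def)
  have "n > 0" using n by simp
  show ?thesis
  proof (rule multiplicity_le_imp_dvd)
    fix p :: nat assume p: "prime p"
    show "multiplicity p n2 \<le> multiplicity p (nat \<bar>k\<bar>)"
    proof (cases "p dvd n2")
      case True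
      then have "multiplicity p n \<le> multiplicity p (nat \<bar>k\<bar>)"
        using le[OF p True] nu_le_iff[OF p \<open>n > 0\<close>, of k] False by blast
      then show ?thesis
        using multiplicity_mult_coprime_left[of p n2 n1] p True n
        by (simp add: mult.commute coprime_commute)
    qed (simp add: not_dvd_imp_multiplicity_0)
  qed (use n in simp)
qed simp

text \<open>
  Every prime factor of \<open>n\<^sub>1\<close> occurs in \<open>e\<close> at most \<open>\<nu>\<^sub>p(k)\<close> times but in \<open>n\<^sub>1\<close> at least two times
  more, so it survives in \<open>n\<^sub>1/e\<close>.
\<close>
lemma nu_split_prime_factors_div:
  assumes "nu_split n k n1 n2" "e dvd gcd n1 (nat \<bar>k\<bar>)"
  shows "prime_factors (n1 div e) = prime_factors n1"
proof (intro equalityI subsetI)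
  from assms have n: "n1 > 0" "n2 > 0" "n = n1 * n2" "coprime n1 n2"
    and ge: "\<And>p. prime p \<Longrightarrow> p dvd n1 \<Longrightarrow> nu p (int n) \<ge> nu p k + 2"
    by (auto simp: nu_split_def)
  have "e dvd n1" using assms(2) by (rule dvd_trans) (rule gcd_dvd1)
  then obtain r where r: "n1 = e * r" ..
  have "n > 0" using n by simp
  have pos: "e > 0" "r > 0" using r n by auto
  have div: "n1 div e = r" using r pos by simp
  fix p
  show "p \<in> prime_factors n1" if "p \<in> prime_factors (n1 div e)"
    using that n pos unfolding div by (auto simp: in_prime_factors_iff r)
  assume "p \<in> prime_factors n1"
  then have p: "prime p" "p dvd n1" by (auto simp: in_prime_factors_iff)
  have k: "k \<noteq> 0" "multiplicity p (nat \<bar>k\<bar>) + 2 \<le> multiplicity p n"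
    using ge[OF p] nu_ge_plus_2_iff[OF p(1) \<open>n > 0\<close>, of k] by blast+
  have "multiplicity p e \<le> multiplicity p (nat \<bar>k\<bar>)"
    using dvd_trans[OF assms(2) gcd_dvd2] k(1) by (intro dvd_imp_multiplicity_le) simp_all
  moreover have "multiplicity p n = multiplicity p e + multiplicity p r"
    using multiplicity_mult_coprime_left[OF p n(4,1,2)] p(1) pos n(3)
    by (simp add: r prime_elem_multiplicity_mult_distrib)
  ultimately have "multiplicity p r > 0" using k(2) by linarith
  then show "p \<in> prime_factors (n1 div e)"
    using p(1) by (simp add: div prime_factors_multiplicity)
qed

text \<open>
  By hypothesis each prime factor \<open>p\<close> of \<open>n\<close> satisfies exactly one of \<open>\<nu>\<^sub>p(n) \<ge> \<nu>\<^sub>p(k) + 2\<close> and \<open>\<nu>\<^sub>p(n) \<le> \<nu>\<^sub>p(k)\<close>: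
  existence of the decomposition needs one of them, uniqueness that they exclude each other. The
  coprime factors must then collect the full prime powers of the respective primes.
\<close>
lemma nu_split_ex1:
  assumes "n > 0" and gap: "\<forall>p::nat. prime p \<and> p dvd n \<longrightarrow> nu p (int n) \<noteq> nu p k + 1"
  shows "\<exists>!(n1, n2). nu_split n k n1 n2"
proof -
  define A where "A = {p \<in> prime_factors n. nu p (int n) \<ge> nu p k + 2}"
  define B where "B = prime_factors n - A"
  define a where "a = (\<Prod>p\<in>A. p ^ multiplicity p n)"
  define b where "b = (\<Prod>p\<in>B. p ^ multiplicity p n)"
  have AB: "finite A" "finite B" "A \<inter> B = {}" "A \<union> B = prime_factors n"
    by (auto simp: A_def B_def)
  have prime: "prime p" if "p \<in> A \<union> B" for p using that AB(4) by auto
  have pos: "a > 0" "b > 0"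
    unfolding a_def b_def using prime by (auto intro!: prod_pos simp: prime_gt_0_nat)
  have "n = (\<Prod>p\<in>A \<union> B. p ^ multiplicity p n)"
    using prime_factorization_nat[OF assms(1)] AB(4) by simp
  also have "\<dots> = a * b" unfolding a_def b_def by (rule prod.union_disjoint) (use AB in auto)
  finally have n: "n = a * b" .
  have dvd_prod: "p \<in> S" if p: "prime p" "p dvd (\<Prod>p\<in>S. p ^ multiplicity p n)" and S: "S \<subseteq> A \<union> B" for p S
  proof -
    have "finite S" using S AB finite_subset by blast
    then obtain q where "q \<in> S" "p dvd q ^ multiplicity q n"
      using p by (auto simp: prime_dvd_prod_iff)
    then show ?thesis
      using p(1) S prime[of q] primes_dvd_imp_eq[of p q] prime_dvd_power[of p q] by blast
  qed
  have ex: "nu_split n k a b"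
    unfolding nu_split_def
  proof (intro conjI allI impI)
    show "coprime a b"
      unfolding a_def b_def using AB(3) prime
      by (intro prod_coprime_left prod_coprime_right) (auto intro!: primes_coprime)
    show "nu p k + 2 \<le> nu p (int n)" if "prime p \<and> p dvd a" for p
      using dvd_prod[of p A] that by (auto simp: a_def A_def)
    show "nu p (int n) \<le> nu p k" if "prime p \<and> p dvd b" for p
    proof -
      have p: "p \<in> B" "prime p" "p dvd n"
        using dvd_prod[of p B] that dvd_mult[of p b a] by (auto simp: b_def[symmetric] n[symmetric])
      then have "\<not> nu p k + 2 \<le> nu p (int n)" unfolding A_def B_def by blast
      then have "\<not> (k \<noteq> 0 \<and> multiplicity p n \<ge> multiplicity p (nat \<bar>k\<bar>) + 2)"
        using nu_ge_plus_2_iff[OF p(2) assms(1), of k] by blast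
      moreover have "k \<noteq> 0 \<Longrightarrow> multiplicity p n \<noteq> multiplicity p (nat \<bar>k\<bar>) + 1"
        using no_unit_gap_nat_abs[OF assms] p by (simp add: no_unit_gap_def)
      ultimately have "k = 0 \<or> multiplicity p n \<le> multiplicity p (nat \<bar>k\<bar>)" by linarith
      then show ?thesis using nu_le_iff[OF p(2) assms(1), of k] by blast
    qed
  qed (use pos n in auto)
  have unique: "x = a \<and> y = b" if "nu_split n k x y" for x y
  proof -
    from that have xy: "x > 0" "y > 0" "n = x * y" "coprime x y"
      and ge: "\<And>p. prime p \<Longrightarrow> p dvd x \<Longrightarrow> nu p (int n) \<ge> nu p k + 2"
      and le: "\<And>p. prime p \<Longrightarrow> p dvd y \<Longrightarrow> nu p (int n) \<le> nu p k"
      by (auto simp: nu_split_def)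
    have "prime_factors x = A"
    proof (intro equalityI subsetI)
      fix p assume "p \<in> prime_factors x"
      then show "p \<in> A" using ge xy by (auto simp: A_def in_prime_factors_iff)
    next
      fix p assume "p \<in> A"
      then have p: "prime p" "p dvd x * y" "nu p (int n) \<ge> nu p k + 2"
        using xy by (auto simp: A_def in_prime_factors_iff)
      have "\<not> p dvd y"
        using le[OF p(1)] p(1,3) assms(1) by (auto simp: nu_ge_plus_2_iff nu_le_iff)
      then show "p \<in> prime_factors x"
        using p xy by (auto simp: in_prime_factors_iff prime_dvd_mult_iff)
    qed
    moreover have "multiplicity p x = multiplicity p n" if "p \<in> prime_factors x" for p
      using multiplicity_mult_coprime_left[of p x y] that xy by (simp add: in_prime_factors_iff)
    ultimately have "(\<Prod>p\<in>prime_factors x. p ^ multiplicity p x) = a"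
      unfolding a_def by (intro prod.cong) auto
    then have "x = a" using prime_factorization_nat[OF xy(1)] by argo
    then show ?thesis using n xy(3) pos(1) by (metis mult_left_cancel not_gr_zero)
  qed
  show ?thesis
  proof (rule ex1I[of _ "(a, b)"])
    show "case (a, b) of (n1, n2) \<Rightarrow> nu_split n k n1 n2" using ex by simp
    fix z assume "case z of (n1, n2) \<Rightarrow> nu_split n k n1 n2"
    then show "z = (a, b)" using unique[of "fst z" "snd z"] by (simp add: case_prod_beta prod_eq_iff)
  qed
qed

section \<open>Factoring the sum over the divisors of (n, k)\<close>

lemma totient_div_same_primes:
  assumes "e dvd n" "prime_factors (n div e) = prime_factors n"
  shows "real (totient n) = real e * real (totient (n div e))"
proof -
  have "real n = real e * real (n div e)"
    using assms(1) by (simp flip: of_nat_mult)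
  then show ?thesis using assms(2) by (simp add: totient_formula2)
qed

lemma jordan_div_same_primes:
  assumes "e dvd n" "n > 0" "prime_factors (n div e) = prime_factors n"
  shows "jordan m n = real e powr m * jordan m (n div e)"
proof -
  have "real n = real e * real (n div e)"
    using assms(1) by (simp flip: of_nat_mult)
  then have "real n powr m = real e powr m * real (n div e) powr m"
    by (simp add: powr_mult)
  then show ?thesis using assms(3) by (simp add: jordan_def)
qed

text \<open>
  Here \<open>gcd (n1 * n2) K = gcd n1 K * n2\<close>, so a divisor \<open>e\<close> is a product \<open>xy\<close> with \<open>x\<close> dividing
  \<open>gcd n1 K\<close> and \<open>y\<close> dividing \<open>n2\<close>. Passing from \<open>n1\<close> to \<open>n1 / x\<close> loses no primes, and
  \<open>\<phi>(n1)/\<phi>(n1/x)\<close> reduces to \<open>x\<close>.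
\<close>
lemma totient_weighted_sum_split:
  assumes "n1 > 0" "n2 > 0" "coprime n1 n2" "n2 dvd K"
    and rad: "\<And>e. e dvd gcd n1 K \<Longrightarrow> prime_factors (n1 div e) = prime_factors n1"
    and g: "\<And>x y. x dvd n1 \<Longrightarrow> y dvd n2 \<Longrightarrow> g (x * y) = u x * v y"
  shows "(\<Sum>e | e dvd gcd (n1 * n2) K.
            g (n1 * n2 div e) * real (totient (n1 * n2)) / real (totient (n1 * n2 div e)))
    = (\<Sum>e | e dvd gcd n1 K. u (n1 div e) * real e)
        * (real (totient n2) * (\<Sum>d | d dvd n2. v d / real (totient d)))"
proof -
  define w where "w e = g (n1 * n2 div e) * real (totient (n1 * n2)) / real (totient (n1 * n2 div e))" for e
  have "gcd (n1 * n2) K = gcd n1 K * n2"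
  proof -
    obtain r where r: "K = n2 * r" using assms(4) ..
    have "gcd (n1 * n2) K = n2 * gcd n1 r" by (simp add: r mult.commute[of n1] gcd_mult_distrib_nat)
    also have "gcd n1 r = gcd n1 K"
      using assms(3) by (simp add: r gcd_mult_right_left_cancel)
    finally show ?thesis by simp
  qed
  moreover have "coprime (gcd n1 K) n2" using assms(3) by (meson coprime_divisors dvd_refl gcd_dvd1)
  ultimately have "(\<Sum>e | e dvd gcd (n1 * n2) K. w e)
      = (\<Sum>x | x dvd gcd n1 K. \<Sum>y | y dvd n2. w (x * y))"
    using assms(1,2) by (simp add: sum_divisors_coprime_mult)
  also have "\<dots> = (\<Sum>x | x dvd gcd n1 K. \<Sum>y | y dvd n2.
      u (n1 div x) * real x * (real (totient n2) * (v (n2 div y) / real (totient (n2 div y)))))"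
  proof (intro sum.cong refl)
    fix x y assume "x \<in> {x. x dvd gcd n1 K}" "y \<in> {y. y dvd n2}"
    then have x: "x dvd gcd n1 K" "x dvd n1" and y: "y dvd n2" by auto
    have div_eq: "n1 * n2 div (x * y) = (n1 div x) * (n2 div y)"
      using x(2) y by (rule div_mult_div_if_dvd[symmetric])
    have dv: "n1 div x dvd n1" "n2 div y dvd n2" using x(2) y by auto
    have "coprime (n1 div x) (n2 div y)" using assms(3) dv by (meson coprime_divisors)
    then have "w (x * y) = u (n1 div x) * v (n2 div y) * (real (totient n1) * real (totient n2))
        / (real (totient (n1 div x)) * real (totient (n2 div y)))"
      using assms(3) by (simp add: w_def div_eq g[OF dv] totient_mult_coprime)
    moreover have "real (totient n1) = real x * real (totient (n1 div x))"
      by (rule totient_div_same_primes[OF x(2) rad[OF x(1)]])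
    moreover have "real (totient (n1 div x)) \<noteq> 0"
      using assms(1) dv(1) by (auto dest: dvd_pos_nat)
    ultimately show "w (x * y) = u (n1 div x) * real x *
        (real (totient n2) * (v (n2 div y) / real (totient (n2 div y))))"
      by (simp add: mult_ac)
  qed
  also have "\<dots> = (\<Sum>e | e dvd gcd n1 K. u (n1 div e) * real e)
        * (real (totient n2) * (\<Sum>y | y dvd n2. v (n2 div y) / real (totient (n2 div y))))"
    by (simp only: sum_product sum_distrib_left[of "real (totient n2)"])
  also have "(\<Sum>y | y dvd n2. v (n2 div y) / real (totient (n2 div y)))
      = (\<Sum>d | d dvd n2. v d / real (totient d))"
    using sum_divisors_flip[OF assms(2), where P = "\<lambda>_. True" and F = "\<lambda>d. v d / real (totient d)"]
    by simp
  finally show ?thesis by (simp add: w_def)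
qed

lemma twisted_totative_sum_split:
  fixes f :: "int \<Rightarrow> real" and g u v :: "nat \<Rightarrow> real"
  assumes "n > 0" "coprime s (int n)" "no_unit_gap n (nat \<bar>k\<bar>)" "nu_split n k n1 n2"
    and f: "\<And>x. f x = (\<Sum>d | d dvd n \<and> int d dvd x - s. g d)"
    and g: "\<And>x y. x dvd n1 \<Longrightarrow> y dvd n2 \<Longrightarrow> g (x * y) = u x * v y"
  shows "(\<Sum>a\<in>totatives n. of_real (f (int a)) * unit_e (of_int (int a * k) / real n))
    = unit_e (of_int (k * s) / real n) * of_real
        ((\<Sum>e | e dvd gcd n1 (nat \<bar>k\<bar>). u (n1 div e) * real e)
        * (real (totient n2) * (\<Sum>d | d dvd n2. v d / real (totient d))))"
proof -
  have n: "n1 > 0" "n2 > 0" "n = n1 * n2" "coprime n1 n2"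
    using assms(4) by (auto simp: nu_split_def)
  show ?thesis
    unfolding twisted_totative_sum[OF assms(1-3) f]
    unfolding n(3)
    by (subst totient_weighted_sum_split[where g = g and u = u and v = v,
          OF n(1,2,4) nu_split_dvd[OF assms(4)] nu_split_prime_factors_div[OF assms(4)] g]) auto
qed

lemma divisors_dvd_int_eq: "n > 0 \<Longrightarrow> {d. d dvd n \<and> int d dvd y} = {d. d dvd nat (gcd y (int n))}"
proof -
  have "d dvd nat (gcd y (int n)) \<longleftrightarrow> int d dvd gcd y (int n)" for d
    by (metis gcd_ge_0_int int_dvd_int_iff int_nat_eq)
  then show ?thesis by auto
qed

lemma nat_gcd_pos: "n > 0 \<Longrightarrow> nat (gcd y (int n)) > 0"
  by simp

lemma jordan_weighted_sum:
  assumes "n > 0" "\<And>e. e dvd gcd n K \<Longrightarrow> prime_factors (n div e) = prime_factors n"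
  shows "(\<Sum>e | e dvd gcd n K. jordan m (n div e) * real e) = jordan m n * sigma (1 - m) (gcd n K)"
  unfolding sigma_def sum_distrib_left
proof (rule sum.cong[OF refl])
  fix e assume "e \<in> {e. e dvd gcd n K}"
  then have e: "e dvd n" "e dvd gcd n K" by auto
  then have "e > 0" using assms(1) by (auto intro: Nat.gr0I)
  then show "jordan m (n div e) * real e = jordan m n * real e powr (1 - m)"
    using jordan_div_same_primes[OF e(1) assms(1) assms(2)[OF e(2)], of m]
    by (simp add: powr_diff)
qed

lemma powr_weighted_sum:
  assumes "n > 0"
  shows "(\<Sum>e | e dvd gcd n K. real (n div e) powr m * real e)
    = real n powr m * sigma (1 - m) (gcd n K)"
  unfolding sigma_def sum_distrib_left
proof (rule sum.cong[OF refl])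
  fix e assume "e \<in> {e. e dvd gcd n K}"
  then have e: "e dvd n" by auto
  then have "e > 0" using assms(1) by (auto intro: Nat.gr0I)
  moreover have "real n = real e * real (n div e)" using e by (simp flip: of_nat_mult)
  ultimately show "real (n div e) powr m * real e = real n powr m * real e powr (1 - m)"
    by (simp add: powr_diff powr_mult)
qed

lemma moebius_weighted_sum:
  assumes "n > 0"
  shows "(\<Sum>e | e dvd gcd n K. real (n div e) * moebius (n div (n div e)) * real e)
    = real n * of_bool (gcd n K = 1)"
proof -
  have "(\<Sum>e | e dvd gcd n K. real (n div e) * moebius (n div (n div e)) * real e)
      = (\<Sum>e | e dvd gcd n K. real n * moebius e)"
  proof (rule sum.cong[OF refl])
    fix e assume "e \<in> {e. e dvd gcd n K}"
    then obtain r where r: "n = e * r" by (auto elim!: dvdE)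
    then show "real (n div e) * moebius (n div (n div e)) * real e = real n * moebius e"
      using assms by simp
  qed
  also have "\<dots> = real n * of_bool (gcd n K = 1)"
    using assms moebius_divisor_sum[of "gcd n K"] by (simp flip: sum_distrib_left)
  finally show ?thesis .
qed

lemma nat_gcd_int: "nat (gcd (int n) k) = gcd n (nat \<bar>k\<bar>)"
  unfolding gcd_int_def by (simp only: nat_int abs_of_nat)

section \<open>Evaluation of the weighted sums\<close>

text \<open>
  The weight is the divisor sum of \<open>J\<^sub>m\<close>, the Moebius transform of the power function.
\<close>
lemma gcd_powr_totative_sum:
  assumes "n > 0" "coprime s (int n)" "no_unit_gap n (nat \<bar>k\<bar>)" "nu_split n k n1 n2"
  shows "(\<Sum>a\<in>totatives n. of_real (of_int (gcd (int a - s) (int n)) powr m)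
            * unit_e (of_int (int a * k) / real n))
    = unit_e (of_int (k * s) / real n)
        * of_real (jordan m n1 * sigma (1 - m) (nat (gcd (int n1) k)) * real (totient n2) * F_sum m n2)"
proof -
  note n = nu_splitD[OF assms(4)]
  define f where "f x = real_of_int (gcd (x - s) (int n)) powr m" for x
  have f: "f x = (\<Sum>d | d dvd n \<and> int d dvd x - s. jordan m d)" for x
    using jordan_divisor_sum[OF nat_gcd_pos[OF assms(1)], of m "x - s"]
    by (simp add: f_def divisors_dvd_int_eq[OF assms(1)])
  have g: "jordan m (x * y) = jordan m x * jordan m y" if "x dvd n1" "y dvd n2" for x y
    using that n(1,2) coprime_divisors[OF that n(4)]
    by (intro multiplicativeD[OF multiplicative_jordan]) (auto intro: dvd_pos_nat)
  have "(\<Sum>a\<in>totatives n. of_real (f (int a)) * unit_e (of_int (int a * k) / real n))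
      = unit_e (of_int (k * s) / real n) * of_real
        ((\<Sum>e | e dvd gcd n1 (nat \<bar>k\<bar>). jordan m (n1 div e) * real e)
        * (real (totient n2) * (\<Sum>d | d dvd n2. jordan m d / real (totient d))))"
    by (rule twisted_totative_sum_split[OF assms f g])
  also have "(\<Sum>e | e dvd gcd n1 (nat \<bar>k\<bar>). jordan m (n1 div e) * real e)
      = jordan m n1 * sigma (1 - m) (nat (gcd (int n1) k))"
    unfolding nat_gcd_int by (rule jordan_weighted_sum[OF n(1) nu_split_prime_factors_div[OF assms(4)]])
  finally show ?thesis by (simp only: f_def F_sum_def mult.assoc)
qed

text \<open>
  With \<open>g = \<phi>\<close> the totients cancel before any splitting of \<open>n\<close>, and each divisor of \<open>(n, k)\<close> contributes
  \<open>\<phi>(n)\<close>.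
\<close>
lemma gcd_totative_sum:
  assumes "n > 0" "coprime s (int n)" "no_unit_gap n (nat \<bar>k\<bar>)"
  shows "(\<Sum>a\<in>totatives n. of_int (gcd (int a - s) (int n))
            * unit_e (of_int (int a * k) / real n))
    = unit_e (of_int (k * s) / real n) * of_real (real (totient n) * tau (nat (gcd (int n) k)))"
proof -
  define f where "f x = real_of_int (gcd (x - s) (int n))" for x
  have f: "f x = (\<Sum>d | d dvd n \<and> int d dvd x - s. real (totient d))" for x
  proof -
    have "f x = real (nat (gcd (x - s) (int n)))" by (simp add: f_def)
    also have "\<dots> = real (\<Sum>d | d dvd nat (gcd (x - s) (int n)). totient d)"
      by (simp only: totient_divisor_sum)
    finally show ?thesis by (simp add: divisors_dvd_int_eq[OF assms(1)])
  qed
  have "(\<Sum>a\<in>totatives n. of_real (f (int a)) * unit_e (of_int (int a * k) / real n))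
      = unit_e (of_int (k * s) / real n) * of_real
        (\<Sum>e | e dvd gcd n (nat \<bar>k\<bar>).
          real (totient (n div e)) * real (totient n) / real (totient (n div e)))"
    by (rule twisted_totative_sum[OF assms f])
  also have "(\<Sum>e | e dvd gcd n (nat \<bar>k\<bar>).
        real (totient (n div e)) * real (totient n) / real (totient (n div e)))
      = real (totient n) * tau (nat (gcd (int n) k))"
    unfolding sigma_def sum_distrib_left nat_gcd_int
  proof (rule sum.cong[OF refl])
    fix e assume "e \<in> {e. e dvd gcd n (nat \<bar>k\<bar>)}"
    then have e: "e dvd n" using dvd_trans gcd_dvd1 by blast
    then have "e > 0" "n div e > 0"
      using assms(1) dvd_imp_le[OF e] by (auto intro!: Nat.gr0I simp: div_eq_0_iff)
    then show "real (totient (n div e)) * real (totient n) / real (totient (n div e))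
        = real (totient n) * real e powr 0"
      by simp
  qed
  finally show ?thesis by (simp only: f_def of_real_of_int_eq)
qed

lemma sigma_gcd_totative_sum:
  assumes "n > 0" "coprime s (int n)" "no_unit_gap n (nat \<bar>k\<bar>)" "nu_split n k n1 n2"
  shows "(\<Sum>a\<in>totatives n. of_real (sigma m (nat (gcd (int a - s) (int n))))
            * unit_e (of_int (int a * k) / real n))
    = unit_e (of_int (k * s) / real n)
        * of_real (real n1 powr m * sigma (1 - m) (nat (gcd (int n1) k)) * real (totient n2) * G_sum m n2)"
proof -
  note n = nu_splitD[OF assms(4)]
  define f where "f x = sigma m (nat (gcd (x - s) (int n)))" for x
  have f: "f x = (\<Sum>d | d dvd n \<and> int d dvd x - s. real d powr m)" for x
    by (simp add: f_def sigma_def divisors_dvd_int_eq[OF assms(1)])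
  have g: "real (x * y) powr m = real x powr m * real y powr m" for x y
    by (simp add: powr_mult)
  have "(\<Sum>a\<in>totatives n. of_real (f (int a)) * unit_e (of_int (int a * k) / real n))
      = unit_e (of_int (k * s) / real n) * of_real
        ((\<Sum>e | e dvd gcd n1 (nat \<bar>k\<bar>). real (n1 div e) powr m * real e)
        * (real (totient n2) * (\<Sum>d | d dvd n2. real d powr m / real (totient d))))"
    by (rule twisted_totative_sum_split[OF assms f g])
  also have "(\<Sum>e | e dvd gcd n1 (nat \<bar>k\<bar>). real (n1 div e) powr m * real e)
      = real n1 powr m * sigma (1 - m) (nat (gcd (int n1) k))"
    unfolding nat_gcd_int by (rule powr_weighted_sum[OF n(1)])
  finally show ?thesis by (simp only: f_def G_sum_def mult.assoc)
qed

text \<open>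
  The weight \<open>d \<mu>(n/d)\<close> depends on \<open>n\<close> as well as on \<open>d\<close>, but still factors along \<open>n\<^sub>1\<close> and \<open>n\<^sub>2\<close>.
  The factor of \<open>n\<^sub>1\<close> is \<open>n\<^sub>1\<close> times the sum of \<open>\<mu>\<close> over the divisors of \<open>(n\<^sub>1, k)\<close>.
\<close>
lemma ramanujan_totative_sum:
  assumes "n > 0" "coprime s (int n)" "no_unit_gap n (nat \<bar>k\<bar>)" "nu_split n k n1 n2"
  shows "(\<Sum>a\<in>totatives n. ramanujan_sum n (int a - s) * unit_e (of_int (int a * k) / real n))
    = (if gcd (int n1) k = 1 \<and> squarefree n2
       then unit_e (of_int (k * s) / real n) * of_nat n1 else 0)"
proof -
  note n = nu_splitD[OF assms(4)]
  define f where "f x = (\<Sum>d | d dvd n \<and> int d dvd x - s. real d * moebius (n div d))" for x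
  have g: "real (x * y) * moebius (n div (x * y))
      = (real x * moebius (n1 div x)) * (real y * moebius (n2 div y))"
    if "x dvd n1" "y dvd n2" for x y
  proof -
    have dv: "n1 div x dvd n1" "n2 div y dvd n2" using that by auto
    have "n div (x * y) = (n1 div x) * (n2 div y)"
      unfolding n(3) using that by (rule div_mult_div_if_dvd[symmetric])
    moreover have "moebius ((n1 div x) * (n2 div y)) = moebius (n1 div x) * moebius (n2 div y)"
      using dv n(1,2) coprime_divisors[OF dv n(4)]
      by (intro multiplicativeD[OF multiplicative_moebius]) (auto intro: dvd_pos_nat)
    ultimately show ?thesis by simp
  qed
  have "(\<Sum>a\<in>totatives n. ramanujan_sum n (int a - s) * unit_e (of_int (int a * k) / real n))
      = (\<Sum>a\<in>totatives n. of_real (f (int a)) * unit_e (of_int (int a * k) / real n))"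
    by (simp only: ramanujan_sum_eq[OF assms(1)] f_def)
  also have "\<dots> = unit_e (of_int (k * s) / real n) * of_real
        ((\<Sum>e | e dvd gcd n1 (nat \<bar>k\<bar>). real (n1 div e) * moebius (n1 div (n1 div e)) * real e)
        * (real (totient n2) * (\<Sum>d | d dvd n2. real d * moebius (n2 div d) / real (totient d))))"
    by (rule twisted_totative_sum_split[OF assms f_def g])
  also have "\<dots> = unit_e (of_int (k * s) / real n) * of_real
      (real n1 * of_bool (gcd n1 (nat \<bar>k\<bar>) = 1) * of_bool (squarefree n2))"
    by (simp only: moebius_weighted_sum[OF n(1)] moebius_totient_sum_squarefree[OF n(2)])
  also have "gcd n1 (nat \<bar>k\<bar>) = 1 \<longleftrightarrow> gcd (int n1) k = 1"
    unfolding nat_gcd_int[symmetric] by (simp add: nat_eq_iff)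
  finally show ?thesis by simp
qed

theorem corollary3p8:
  fixes n :: nat and s k :: int
  assumes "n > 0"
    and "coprime s (int n)"
    and "\<forall>p::nat. prime p \<and> p dvd n \<longrightarrow> nu p (int n) \<noteq> nu p k + 1"
  shows "(\<exists>!(n1, n2). nu_split n k n1 n2) \<and>
    (\<forall>n1 n2. nu_split n k n1 n2 \<longrightarrow>
      (\<forall>m::real. m \<noteq> 1 \<longrightarrow>
        (\<Sum>a\<in>totatives n. of_real (of_int (gcd (int a - s) (int n)) powr m)
            * unit_e (of_int (int a * k) / real n))
          = unit_e (of_int (k * s) / real n)
            * of_real (jordan m n1 * sigma (1 - m) (nat (gcd (int n1) k))
                * real (totient n2) * F_sum m n2) \<and>
        F_sum m n2 =
          (\<Prod>p\<in>prime_factors n2. 1 + (real p powr m - 1) / (real p - 1)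
             * ((real p powr ((m - 1) * real (multiplicity p n2)) - 1)
                 / (real p powr (m - 1) - 1)))) \<and>
      (\<Sum>a\<in>totatives n. of_int (gcd (int a - s) (int n))
            * unit_e (of_int (int a * k) / real n))
        = unit_e (of_int (k * s) / real n)
          * of_real (real (totient n) * tau (nat (gcd (int n) k))) \<and>
      (\<forall>m::real. m \<noteq> 1 \<longrightarrow>
        (\<Sum>a\<in>totatives n. of_real (sigma m (nat (gcd (int a - s) (int n))))
            * unit_e (of_int (int a * k) / real n))
          = unit_e (of_int (k * s) / real n)
            * of_real (real n1 powr m * sigma (1 - m) (nat (gcd (int n1) k))
                * real (totient n2) * G_sum m n2) \<and>
        G_sum m n2 =
          (\<Prod>p\<in>prime_factors n2. 1 + real p powr m / (real p - 1)
             * ((real p powr ((m - 1) * real (multiplicity p n2)) - 1)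
                 / (real p powr (m - 1) - 1)))) \<and>
      (\<Sum>a\<in>totatives n. of_real (sigma 1 (nat (gcd (int a - s) (int n))))
            * unit_e (of_int (int a * k) / real n))
        = unit_e (of_int (k * s) / real n)
          * of_real (real n1 * tau (nat (gcd (int n1) k))
              * real (totient n2) * G_sum 1 n2) \<and>
      G_sum 1 n2 =
        (\<Prod>p\<in>prime_factors n2. 1 + real p * real (multiplicity p n2) / (real p - 1)) \<and>
      (\<Sum>a\<in>totatives n. ramanujan_sum n (int a - s)
            * unit_e (of_int (int a * k) / real n))
        = (if gcd (int n1) k = 1 \<and> squarefree n2
           then unit_e (of_int (k * s) / real n) * of_nat n1 else 0))"
proof -
  have gap: "no_unit_gap n (nat \<bar>k\<bar>)" using assms by (intro no_unit_gap_nat_abs)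
  note hyps = assms(1,2) gap
  show ?thesis
  proof (intro conjI allI impI)
    show "\<exists>!(n1, n2). nu_split n k n1 n2" by (rule nu_split_ex1[OF assms(1,3)])
  next
    fix n1 n2 assume split: "nu_split n k n1 n2"
    note n = nu_splitD[OF split]
    show "(\<Sum>a\<in>totatives n. of_real (sigma 1 (nat (gcd (int a - s) (int n))))
            * unit_e (of_int (int a * k) / real n))
        = unit_e (of_int (k * s) / real n)
          * of_real (real n1 * tau (nat (gcd (int n1) k))
              * real (totient n2) * G_sum 1 n2)"
      using sigma_gcd_totative_sum[OF hyps split, of 1] n(1) by simp
  qed (assumption | rule F_sum_eq_prod G_sum_eq_prod G_sum_1_eq_prod nu_splitD(2)
        gcd_powr_totative_sum[OF hyps] gcd_totative_sum[OF hyps]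
        sigma_gcd_totative_sum[OF hyps] ramanujan_totative_sum[OF hyps])+
qed

end
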